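(* Let $N\geq 1$ be an integer, $p>1$, $q\geq 1$, $\alpha\geq 1$ and $\varrho>-1$ be real numbers. Assume that $$q>\frac{N(p-1)}{2},\qquad q\geq p,\qquad \mathbf{w}\in L^q(\mathbb{R}^N).$$ Then, for any $T>0$, the initial value problem $$\partial_t u-\Delta u=\|u(t)\|_q^{\alpha}|u|^p+t^{\varrho}\,\mathbf{w}(x),\qquad u(x,0)=u_0(x),$$ on $\mathbb{R}^N$ admits at most one solution (in the integral sense) in the space $C([0,T],L^q(\mathbb{R}^N))$.
   Context: Here $\|\cdot\|_q$ denotes the norm of $L^q(\mathbb{R}^N)$, and $\|u(t)\|_q=\|u(\cdot,t)\|_{L^q(\mathbb{R}^N)}$. Let $\mathbf{S}(t)=e^{t\Delta}$ be the heat semigroup on $\mathbb{R}^N$: $\mathbf{S}(t)\varphi=G(\cdot,t)\star\varphi$ with $G(x,t)=(4\pi t)^{-N/2}e^{-|x|^2/(4t)}$ for $t>0$, and $\mathbf{S}(0)=\mathrm{Id}$. A solution in $C([0,T],L^q(\mathbb{R}^N))$ with initial data $u_0$ is understood in the integral sense, i.e. as a function $u\in C([0,T],L^q(\mathbb{R}^N))$ satisfying $$u(t)=\mathbf{S}(t)u_0+\int_0^t\mathbf{S}(t-\tau)\big(\|u(\tau)\|_q^{\alpha}|u(\tau)|^p\big)\,d\tau+\int_0^t\tau^{\varrho}\,\mathbf{S}(t-\tau)\mathbf{w}\,d\tau,\qquad t\in[0,T].$$ *)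

theory Defs
  imports "HOL-Analysis.Analysis"
begin

text \<open>
  Elements of \<open>L\<^sup>q(\<real>\<^sup>N)\<close> are represented by functions, not by equivalence classes; equality in
  \<open>L\<^sup>q\<close> is therefore equality almost everywhere.
\<close>

definition in_Lq :: "real \<Rightarrow> (real ^ 'n \<Rightarrow> real) \<Rightarrow> bool" where
  "in_Lq q f \<longleftrightarrow> f \<in> borel_measurable lebesgue \<and> integrable lebesgue (\<lambda>x. \<bar>f x\<bar> powr q)"

text \<open>Meaningful only for members of \<open>L\<^sup>q\<close>: a divergent integral has the value 0.\<close>

definition Lq_norm :: "real \<Rightarrow> (real ^ 'n \<Rightarrow> real) \<Rightarrow> real" where
  "Lq_norm q f = (LINT x|lebesgue. \<bar>f x\<bar> powr q) powr (1 / q)"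

definition Lq_dist :: "real \<Rightarrow> (real ^ 'n \<Rightarrow> real) \<Rightarrow> (real ^ 'n \<Rightarrow> real) \<Rightarrow> real" where
  "Lq_dist q f g = Lq_norm q (\<lambda>x. f x - g x)"

definition continuous_in_Lq :: "real \<Rightarrow> real \<Rightarrow> (real \<Rightarrow> real ^ 'n \<Rightarrow> real) \<Rightarrow> bool" where
  "continuous_in_Lq q T u \<longleftrightarrow>
     (\<forall>t\<in>{0..T}. in_Lq q (u t)) \<and>
     (\<forall>t\<in>{0..T}. ((\<lambda>s. Lq_dist q (u s) (u t)) \<longlongrightarrow> 0) (at t within {0..T}))"

text \<open>
  The Bochner integral of an \<open>L\<^sup>q\<close>-valued function on \<open>[a,b]\<close>. The library's Bochner integral needs
  the values to lie in a Banach-space type, which \<open>L\<^sup>q\<close> with a real parameter \<open>q\<close> is not, so the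
  usual definition by approximation with simple functions is written out. No measurability of
  \<open>\<tau> \<mapsto> \<parallel>f \<tau> - s i \<tau>\<parallel>\<close> need be required: it follows from the almost everywhere convergence,
  because Lebesgue measure is complete.
\<close>

definition Lq_simple :: "real \<Rightarrow> real \<Rightarrow> real \<Rightarrow> (real \<Rightarrow> real ^ 'n \<Rightarrow> real) \<Rightarrow> bool" where
  "Lq_simple q a b s \<longleftrightarrow>
     simple_function (lebesgue_on {a..b}) s \<and> (\<forall>\<tau>\<in>{a..b}. in_Lq q (s \<tau>))"

definition Lq_simple_integral ::
    "real \<Rightarrow> real \<Rightarrow> (real \<Rightarrow> real ^ 'n \<Rightarrow> real) \<Rightarrow> real ^ 'n \<Rightarrow> real" where
  "Lq_simple_integral a b s =
     (\<lambda>x. \<Sum>\<phi>\<in>s ` {a..b}. measure lebesgue {\<tau>\<in>{a..b}. s \<tau> = \<phi>} * \<phi> x)"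

definition has_Lq_integral ::
    "real \<Rightarrow> real \<Rightarrow> real \<Rightarrow> (real \<Rightarrow> real ^ 'n \<Rightarrow> real) \<Rightarrow> (real ^ 'n \<Rightarrow> real) \<Rightarrow> bool" where
  "has_Lq_integral q a b f I \<longleftrightarrow>
     in_Lq q I \<and>
     (AE \<tau> in lebesgue_on {a..b}. in_Lq q (f \<tau>)) \<and>
     (\<exists>s. (\<forall>i::nat. Lq_simple q a b (s i)) \<and>
          (AE \<tau> in lebesgue_on {a..b}. (\<lambda>i. Lq_dist q (f \<tau>) (s i \<tau>)) \<longlonglongrightarrow> 0) \<and>
          ((\<lambda>i. \<integral>\<^sup>+\<tau>. ennreal (Lq_dist q (f \<tau>) (s i \<tau>)) \<partial>lebesgue_on {a..b}) \<longlonglongrightarrow> 0) \<and>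
          ((\<lambda>i. Lq_dist q (Lq_simple_integral a b (s i)) I) \<longlonglongrightarrow> 0))"

definition heat_kernel :: "real ^ 'n \<Rightarrow> real \<Rightarrow> real" where
  "heat_kernel x t =
     (4 * pi * t) powr (- (real CARD('n) / 2)) * exp (- ((norm x)\<^sup>2 / (4 * t)))"

text \<open>Used only for \<open>t \<ge> 0\<close>.\<close>

definition heat_semigroup :: "real \<Rightarrow> (real ^ 'n \<Rightarrow> real) \<Rightarrow> real ^ 'n \<Rightarrow> real" where
  "heat_semigroup t \<phi> =
     (if t = 0 then \<phi> else (\<lambda>x. LINT y|lebesgue. heat_kernel (x - y) t * \<phi> y))"

text \<open>
  At \<open>\<tau> = 0\<close> the library has \<open>0 powr \<rho> = 0\<close>, and at \<open>\<tau> = t\<close> the nonlinear term need not lie in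
  \<open>L\<^sup>q\<close>; both concern single points and do not affect the integrals.
\<close>

definition integral_solution ::
    "real \<Rightarrow> real \<Rightarrow> real \<Rightarrow> real \<Rightarrow> (real ^ 'n \<Rightarrow> real) \<Rightarrow> (real ^ 'n \<Rightarrow> real) \<Rightarrow> real \<Rightarrow>
     (real \<Rightarrow> real ^ 'n \<Rightarrow> real) \<Rightarrow> bool" where
  "integral_solution p q \<alpha> \<rho> w u0 T u \<longleftrightarrow>
     continuous_in_Lq q T u \<and>
     (\<forall>t\<in>{0..T}. \<exists>I J.
        has_Lq_integral q 0 t
          (\<lambda>\<tau>. heat_semigroup (t - \<tau>) (\<lambda>x. Lq_norm q (u \<tau>) powr \<alpha> * \<bar>u \<tau> x\<bar> powr p)) I \<and>
        has_Lq_integral q 0 t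
          (\<lambda>\<tau> x. \<tau> powr \<rho> * heat_semigroup (t - \<tau>) w x) J \<and>
        (AE x in lebesgue. u t x = heat_semigroup t u0 x + I x + J x))"

end

theory Submission
  imports Defs "HOL-Probability.Distributions"
begin

text \<open>
  The difference of two solutions is the Bochner integral of \<open>S(t - \<tau>)\<close> applied to a difference of
  nonlinear terms, which by Hoelder's inequality is Lipschitz from bounded sets of \<open>L\<^sup>q\<close> to \<open>L\<^bsup>q/p\<^esup>\<close>.
  Since \<open>S(t)\<close> maps \<open>L\<^bsup>q/p\<^esup>\<close> to \<open>L\<^sup>q\<close> with norm at most \<open>(4\<pi>t)\<^bsup>-\<beta>\<^esup>\<close> for \<open>\<beta> = N(p - 1)/(2q) < 1\<close>, the
  distance of the solutions satisfies a Gronwall inequality with an integrable singularity and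
  therefore vanishes.
\<close>

text \<open>The two conditions on \<open>q\<close> act at different places: \<open>q \<ge> p\<close>
  makes \<open>q / p \<ge> 1\<close>, so that Minkowski and Jensen are available in L^(q/p), while
  \<open>q > N (p - 1) / 2\<close> makes the kernel (t - \<tau>)^(-\<beta>) integrable. The obstacle
  is measurability in time. The Bochner integrals are given through approximating simple functions,
  and the norm of the integrand is not known in advance to be a measurable function of \<tau>. Hence
  two integrals are compared through their approximations, with the norm of the difference replaced
  by an explicit measurable majorant, and the Gronwall step bounds the distance of the solutions by
  constants on short intervals. The integrals in \<open>integral_solution\<close> are existentially
  quantified, so the forcing terms of two solutions cancel only once a Bochner integral is known to
  be unique almost everywhere. Minkowski, Jensen and the mean value bound all come from one tangent
  line inequality for powers; Hoelder comes from Young's inequality.\<close>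

section \<open>Convexity inequalities for real powers\<close>

text \<open>A convex function lies above its tangent: the left side is c^q + q c^(q-1) (x - c),
  written so that only the ratio \<open>x / c\<close> appears.\<close>

lemma powr_ge_tangent_line:
  fixes c q x :: real
  assumes "q \<ge> 1" "c > 0" "x \<ge> 0"
  shows "c powr q * (q * (x / c - 1) + 1) \<le> x powr q"
proof (cases "x = 0")
  case True
  then show ?thesis using assms by (simp add: mult_nonneg_nonpos)
next
  case False
  define y where "y = x / c"
  have y: "y > 0" using False assms by (simp add: y_def)
  \<comment> \<open>Young's inequality with second factor 1 is Bernoulli's inequality for
    \<open>y powr q\<close> in disguise.\<close>
  have "(y powr q) powr (1/q) * 1 powr (1 - 1/q) \<le> 1/q * y powr q + (1 - 1/q) * 1"
    using assms y by (intro Youngs_inequality_0) auto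
  then have "y \<le> 1/q * y powr q + (1 - 1/q)"
    using assms y by (simp add: powr_powr)
  then have "q * y \<le> q * (1/q * y powr q + (1 - 1/q))"
    using assms by (intro mult_left_mono) auto
  also have "\<dots> = y powr q + q - 1"
    using assms by (simp add: field_simps)
  finally have "q * (y - 1) + 1 \<le> y powr q"
    by (simp add: algebra_simps)
  then have "c powr q * (q * (y - 1) + 1) \<le> c powr q * y powr q"
    by (intro mult_left_mono) auto
  also have "\<dots> = x powr q"
    using y assms by (simp add: y_def flip: powr_mult)
  finally show ?thesis by (simp add: y_def)
qed

text \<open>Convexity at the points a/A and b/B with weights A/(A+B) and B/(A+B), whose mean is
  (a+b)/(A+B). With A and B bounds for the norms of two functions this is Minkowski's inequality
  before integration.\<close>

lemma powr_mean_le: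
  fixes A B a b q :: real
  assumes "q \<ge> 1" "A > 0" "B > 0" "a \<ge> 0" "b \<ge> 0"
  shows "(a + b) powr q \<le> (A + B) powr q * (A / (A + B) * (a powr q / A powr q) + B / (A + B) * (b powr q / B powr q))"
proof (cases "a + b = 0")
  case True
  then show ?thesis using assms by simp
next
  case False
  define s where "s = (a + b) / (A + B)"
  have s: "s > 0" using False assms by (simp add: s_def add_pos_pos)
  have 1: "s powr q * (q * (a / A / s - 1) + 1) \<le> (a / A) powr q"
    and 2: "s powr q * (q * (b / B / s - 1) + 1) \<le> (b / B) powr q"
    using s assms powr_ge_tangent_line[of q s "a / A"] powr_ge_tangent_line[of q s "b / B"] by simp_all
  have AB: "A + B > 0" using assms by simp
  \<comment> \<open>Both tangents are taken at the weighted mean \<open>s\<close>, so their linear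
    parts cancel in the weighted sum.\<close>
  have "(A * (q * (a / A / s - 1) + 1) + B * (q * (b / B / s - 1) + 1)) = q * ((a + b) / s - (A + B)) + (A + B)"
    using assms s by (simp add: algebra_simps add_divide_distrib)
  also have "\<dots> = A + B" using False AB by (simp add: s_def)
  finally have "s powr q * (A + B) = s powr q * (A * (q * (a / A / s - 1) + 1) + B * (q * (b / B / s - 1) + 1))"
    by simp
  also have "\<dots> = A * (s powr q * (q * (a / A / s - 1) + 1)) + B * (s powr q * (q * (b / B / s - 1) + 1))"
    by (simp only: ring_distribs mult_ac)
  also have "\<dots> \<le> A * (a / A) powr q + B * (b / B) powr q"
    using 1 2 assms by (intro add_mono mult_left_mono) auto
  finally have "s powr q \<le> (A * (a / A) powr q + B * (b / B) powr q) / (A + B)"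
    using AB by (simp add: pos_le_divide_eq)
  then have "s powr q \<le> A / (A + B) * (a / A) powr q + B / (A + B) * (b / B) powr q"
    by (simp add: add_divide_distrib)
  then have "(A + B) powr q * s powr q \<le> (A + B) powr q * (A / (A + B) * (a powr q / A powr q) + B / (A + B) * (b powr q / B powr q))"
    using assms by (intro mult_left_mono) (auto simp: powr_divide)
  also have "(A + B) powr q * s powr q = (a + b) powr q"
    using s AB by (simp add: s_def flip: powr_mult)
  finally show ?thesis .
qed

text \<open>The tangent at the larger point gives the factor max(a,b)^(p-1); enlarging it to
  (a+b)^(p-1) makes the bound symmetric, and lets Hoelder's inequality be applied to |f| +
  |g|.\<close>

lemma abs_powr_diff_le:
  fixes a b p :: real
  assumes "p \<ge> 1" "a \<ge> 0" "b \<ge> 0"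
  shows "\<bar>a powr p - b powr p\<bar> \<le> p * (a + b) powr (p - 1) * \<bar>a - b\<bar>"
proof -
  have *: "a powr p - b powr p \<le> p * (a + b) powr (p - 1) * (a - b)"
    if "a > b" "b \<ge> 0" for a b :: real
  proof -
    have "a powr p * (p * (b / a - 1) + 1) \<le> b powr p"
      using that assms by (intro powr_ge_tangent_line) auto
    then have "a powr p - b powr p \<le> p * (a powr p / a) * (a - b)"
      using that by (simp add: field_simps)
    also have "a powr p / a = a powr (p - 1)"
      using that by (simp add: powr_diff)
    also have "p * a powr (p - 1) * (a - b) \<le> p * (a + b) powr (p - 1) * (a - b)"
      using that assms by (intro mult_right_mono mult_left_mono powr_mono2) auto
    finally show ?thesis .
  qed
  have **: "\<bar>a powr p - b powr p\<bar> = a powr p - b powr p" if "a > b" "b \<ge> 0" for a b :: real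
    using that assms powr_mono2[of p b a] by simp
  consider "a > b" | "a = b" | "b > a" by linarith
  then show ?thesis
  proof cases
    case 1
    then show ?thesis using *[of b a] **[of b a] assms by simp
  next
    case 3
    then show ?thesis using *[of a b] **[of a b] assms by (simp add: abs_minus_commute add.commute)
  qed simp
qed

section \<open>The seminorm of L^q: Minkowski and Hoelder\<close>

lemma in_Lq_measurable [measurable_dest]: "in_Lq q f \<Longrightarrow> f \<in> borel_measurable lebesgue"
  and in_Lq_integrable: "in_Lq q f \<Longrightarrow> integrable lebesgue (\<lambda>x. \<bar>f x\<bar> powr q)"
  by (auto simp: in_Lq_def)

lemma Lq_norm_nonneg [simp]: "Lq_norm q f \<ge> 0"
  and Lq_dist_nonneg [simp]: "Lq_dist q f g \<ge> 0"
  by (auto simp: Lq_norm_def Lq_dist_def)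

lemma Lq_norm_powr:
  assumes "q > 0"
  shows "Lq_norm q f powr q = (LINT x|lebesgue. \<bar>f x\<bar> powr q)"
  using assms by (simp add: Lq_norm_def powr_powr)

lemma Lq_norm_le_iff:
  assumes "q > 0" "C \<ge> 0"
  shows "Lq_norm q f \<le> C \<longleftrightarrow> (LINT x|lebesgue. \<bar>f x\<bar> powr q) \<le> C powr q"
proof -
  have "Lq_norm q f \<le> C \<longleftrightarrow> Lq_norm q f powr q \<le> C powr q"
    using assms by (metis Lq_norm_nonneg not_less powr_less_mono2 powr_mono2 less_imp_le)
  then show ?thesis using assms by (simp add: Lq_norm_powr)
qed

lemma Lq_norm_AE_mono:
  fixes f g :: "real ^ 'n \<Rightarrow> real"
  assumes "q > 0" "f \<in> borel_measurable lebesgue" "in_Lq q g" "AE x in lebesgue. \<bar>f x\<bar> \<le> \<bar>g x\<bar>"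
  shows "in_Lq q f" "Lq_norm q f \<le> Lq_norm q g"
proof -
  have AE: "AE x in lebesgue. \<bar>f x\<bar> powr q \<le> \<bar>g x\<bar> powr q"
    using assms(4) by eventually_elim (use assms in \<open>auto intro: powr_mono2\<close>)
  have "integrable lebesgue (\<lambda>x. \<bar>f x\<bar> powr q)"
    using assms(2) AE
    by (intro Bochner_Integration.integrable_bound[OF in_Lq_integrable[OF assms(3)]]) auto
  then show f: "in_Lq q f"
    using assms by (auto simp: in_Lq_def)
  show "Lq_norm q f \<le> Lq_norm q g"
    unfolding Lq_norm_def using assms in_Lq_integrable[OF f] in_Lq_integrable[OF assms(3)] AE
    by (intro powr_mono2 integral_mono_AE) auto
qed

lemma Lq_norm_cong_AE:
  assumes "f \<in> borel_measurable lebesgue" "g \<in> borel_measurable lebesgue" "AE x in lebesgue. f x = g x"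
  shows "Lq_norm q f = Lq_norm q g"
proof -
  have "(LINT x|lebesgue. \<bar>f x\<bar> powr q) = (LINT x|lebesgue. \<bar>g x\<bar> powr q)"
    using assms by (intro integral_cong_AE) auto
  then show ?thesis by (simp add: Lq_norm_def)
qed

lemma Lq_norm_eq_0_iff:
  assumes "q > 0" "in_Lq q f"
  shows "Lq_norm q f = 0 \<longleftrightarrow> (AE x in lebesgue. f x = 0)"
  using assms integral_nonneg_eq_0_iff_AE[OF in_Lq_integrable[OF assms(2)]]
  by (simp add: Lq_norm_def)

lemma Lq_norm_zero [simp]: "q > 0 \<Longrightarrow> Lq_norm q (\<lambda>x. 0) = 0"
  and in_Lq_zero [simp]: "q > 0 \<Longrightarrow> in_Lq q (\<lambda>x. 0)"
  by (auto simp: Lq_norm_def in_Lq_def)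

lemma in_Lq_cmult: "in_Lq q f \<Longrightarrow> in_Lq q (\<lambda>x. c * f x)"
  by (auto simp: in_Lq_def abs_mult powr_mult)

lemma Lq_norm_cmult:
  assumes "q > 0"
  shows "Lq_norm q (\<lambda>x. c * f x) = \<bar>c\<bar> * Lq_norm q f"
  using assms by (simp add: Lq_norm_def abs_mult powr_mult powr_powr)

text \<open>Minkowski's inequality: in the integrated form of \<open>powr_mean_le\<close> each
  quotient of integrals is at most 1, so the weighted mean in the bracket is at most 1.\<close>

lemma Lq_norm_add:
  fixes f g :: "real ^ 'n \<Rightarrow> real"
  assumes q: "q \<ge> 1" and f: "in_Lq q f" and g: "in_Lq q g"
  shows "in_Lq q (\<lambda>x. f x + g x)" "Lq_norm q (\<lambda>x. f x + g x) \<le> Lq_norm q f + Lq_norm q g"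
proof -
  note [measurable] = in_Lq_measurable[OF f] in_Lq_measurable[OF g]
  note int [simp] = in_Lq_integrable[OF f] in_Lq_integrable[OF g]
  \<comment> \<open>Positive upper bounds \<open>A\<close> and \<open>B\<close> stand in for the
    norms, so that division is safe when a norm is 0; they are brought down to the norms at the
    end.\<close>
  have bound: "in_Lq q (\<lambda>x. f x + g x) \<and> (LINT x|lebesgue. \<bar>f x + g x\<bar> powr q) \<le> (A + B) powr q"
    if A: "A \<ge> Lq_norm q f" "A > 0" and B: "B \<ge> Lq_norm q g" "B > 0" for A B
  proof -
    let ?h = "\<lambda>x. (A + B) powr q * (A / (A + B) * (\<bar>f x\<bar> powr q / A powr q) + B / (A + B) * (\<bar>g x\<bar> powr q / B powr q))"
    have le: "\<bar>f x + g x\<bar> powr q \<le> ?h x" for x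
    proof -
      have "\<bar>f x + g x\<bar> powr q \<le> (\<bar>f x\<bar> + \<bar>g x\<bar>) powr q"
        using q by (intro powr_mono2) auto
      also have "\<dots> \<le> ?h x"
        using q that by (intro powr_mean_le) auto
      finally show ?thesis .
    qed
    have h: "integrable lebesgue ?h" by simp
    have i: "integrable lebesgue (\<lambda>x. \<bar>f x + g x\<bar> powr q)"
    proof (rule Bochner_Integration.integrable_bound[OF h])
      show "AE x in lebesgue. norm (\<bar>f x + g x\<bar> powr q) \<le> norm (?h x)"
        using order_trans[OF le abs_ge_self]
        by (intro AE_I2) (simp only: real_norm_def abs_of_nonneg[OF powr_ge_zero])
    qed measurable
    have "(LINT x|lebesgue. \<bar>f x + g x\<bar> powr q) \<le> (LINT x|lebesgue. ?h x)"
      using le by (intro integral_mono i h)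
    also have "\<dots> = (A + B) powr q * (A / (A + B) * ((LINT x|lebesgue. \<bar>f x\<bar> powr q) / A powr q)
        + B / (A + B) * ((LINT x|lebesgue. \<bar>g x\<bar> powr q) / B powr q))"
      by simp
    also have "\<dots> \<le> (A + B) powr q * (A / (A + B) * 1 + B / (A + B) * 1)"
      using that q Lq_norm_le_iff[of q A f] Lq_norm_le_iff[of q B g]
      by (intro mult_left_mono add_mono) auto
    also have "\<dots> = (A + B) powr q"
      using that by (simp flip: add_divide_distrib)
    finally show ?thesis using i by (auto simp: in_Lq_def)
  qed
  show "in_Lq q (\<lambda>x. f x + g x)"
    using bound[of "Lq_norm q f + 1" "Lq_norm q g + 1"] by (auto simp: add_nonneg_pos)
  show "Lq_norm q (\<lambda>x. f x + g x) \<le> Lq_norm q f + Lq_norm q g"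
  proof (rule field_le_epsilon)
    fix e :: real assume "e > 0"
    then show "Lq_norm q (\<lambda>x. f x + g x) \<le> Lq_norm q f + Lq_norm q g + e"
      using bound[of "Lq_norm q f + e/2" "Lq_norm q g + e/2"] q
        Lq_norm_le_iff[of q "Lq_norm q f + Lq_norm q g + e" "\<lambda>x. f x + g x"]
      by (simp add: add_nonneg_pos add_ac)
  qed
qed

lemma Lq_norm_minus [simp]: "Lq_norm q (\<lambda>x. - f x) = Lq_norm q f"
  by (simp add: Lq_norm_def)

lemma in_Lq_diff:
  assumes "q \<ge> 1" "in_Lq q f" "in_Lq q g"
  shows "in_Lq q (\<lambda>x. f x - g x)"
  using Lq_norm_add(1)[OF assms(1,2) in_Lq_cmult[OF assms(3), of "-1"]] by simp

lemma Lq_dist_commute: "Lq_dist q f g = Lq_dist q g f"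
  by (simp add: Lq_dist_def Lq_norm_def abs_minus_commute)

lemma Lq_dist_triangle:
  assumes "q \<ge> 1" "in_Lq q f" "in_Lq q g" "in_Lq q h"
  shows "Lq_dist q f h \<le> Lq_dist q f g + Lq_dist q g h"
  using Lq_norm_add(2)[OF assms(1) in_Lq_diff[OF assms(1,2,3)] in_Lq_diff[OF assms(1,3,4)]]
  by (simp add: Lq_dist_def)

lemma abs_Lq_norm_diff_le:
  assumes "q \<ge> 1" "in_Lq q f" "in_Lq q g"
  shows "\<bar>Lq_norm q f - Lq_norm q g\<bar> \<le> Lq_dist q f g"
proof -
  have "in_Lq q (\<lambda>x. 0)" using assms by simp
  from Lq_dist_triangle[OF assms(1,2,3) this] Lq_dist_triangle[OF assms(1,3,2) this]
  show ?thesis by (simp add: Lq_dist_def[of q _ "\<lambda>x. 0"] Lq_dist_commute[of q g f])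
qed

lemma Lq_norm_sum:
  assumes "q \<ge> 1" "finite S" "\<And>s. s \<in> S \<Longrightarrow> in_Lq q (f s)"
  shows "in_Lq q (\<lambda>x. \<Sum>s\<in>S. f s x) \<and> Lq_norm q (\<lambda>x. \<Sum>s\<in>S. f s x) \<le> (\<Sum>s\<in>S. Lq_norm q (f s))"
  using assms(2,3)
proof (induction rule: finite_induct)
  case empty
  then show ?case using assms(1) by simp
next
  case (insert s S)
  then show ?case
    using Lq_norm_add[OF assms(1), of "f s" "\<lambda>x. \<Sum>s\<in>S. f s x"] by force
qed

text \<open>Hoelder's inequality for the exponents \<open>p / (p - 1)\<close> and \<open>p\<close>, applied to \<open>q / p\<close>-th powers.\<close>

lemma Lq_norm_powr_mult:
  fixes f g :: "real ^ 'n \<Rightarrow> real"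
  assumes p: "p > 1" and q: "q > 0" and f: "in_Lq q f" and g: "in_Lq q g"
  shows "in_Lq (q / p) (\<lambda>x. \<bar>f x\<bar> powr (p - 1) * g x)"
    "Lq_norm (q / p) (\<lambda>x. \<bar>f x\<bar> powr (p - 1) * g x) \<le> Lq_norm q f powr (p - 1) * Lq_norm q g"
proof -
  note [measurable] = in_Lq_measurable[OF f] in_Lq_measurable[OF g]
  note int [simp] = in_Lq_integrable[OF f] in_Lq_integrable[OF g]
  let ?k = "\<lambda>x. \<bar>\<bar>f x\<bar> powr (p - 1) * g x\<bar> powr (q / p)"
  have bound: "integrable lebesgue ?k \<and> (LINT x|lebesgue. ?k x) \<le> (A powr (p - 1) * B) powr (q / p)"
    if A: "A \<ge> Lq_norm q f" "A > 0" and B: "B \<ge> Lq_norm q g" "B > 0" for A B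
  proof -
    let ?h = "\<lambda>x. (A powr (p - 1) * B) powr (q / p) *
      ((1 - 1/p) * (\<bar>f x\<bar> powr q / A powr q) + 1/p * (\<bar>g x\<bar> powr q / B powr q))"
    have le: "?k x \<le> ?h x" for x
    proof (cases "f x = 0 \<or> g x = 0")
      case True
      then show ?thesis using p A B by auto
    next
      case False
      let ?a = "\<bar>f x\<bar> / A" and ?b = "\<bar>g x\<bar> / B"
      \<comment> \<open>The weights are chosen so that q (1 - 1/p) = (p - 1) q/p and q (1/p) = q/p:
        the product of the powers is then the q/p-th power of
        \<open>?a powr (p - 1) * ?b\<close>.\<close>
      have "(?a powr q) powr (1 - 1/p) * (?b powr q) powr (1/p) \<le> (1 - 1/p) * ?a powr q + 1/p * ?b powr q"
        using False A B p by (intro Youngs_inequality_0) auto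
      also have "(?a powr q) powr (1 - 1/p) * (?b powr q) powr (1/p) = (?a powr (p - 1) * ?b) powr (q / p)"
      proof -
        have "q * (1 - 1/p) = (p - 1) * (q / p)" "q * (1/p) = q / p"
          using p by (auto simp: field_simps)
        then show ?thesis by (simp only: powr_powr powr_mult)
      qed
      finally have "(A powr (p - 1) * B) powr (q / p) * (?a powr (p - 1) * ?b) powr (q / p) \<le>
          (A powr (p - 1) * B) powr (q / p) * ((1 - 1/p) * ?a powr q + 1/p * ?b powr q)"
        by (intro mult_left_mono) auto
      moreover have "?k x = (A powr (p - 1) * B) powr (q / p) * (?a powr (p - 1) * ?b) powr (q / p)"
      proof -
        have "A powr (p - 1) * B * (?a powr (p - 1) * ?b) = \<bar>\<bar>f x\<bar> powr (p - 1) * g x\<bar>"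
          using A B by (simp add: abs_mult powr_divide)
        then show ?thesis by (simp only: flip: powr_mult)
      qed
      moreover have "?a powr q = \<bar>f x\<bar> powr q / A powr q" "?b powr q = \<bar>g x\<bar> powr q / B powr q"
        using A B by (auto simp: powr_divide)
      ultimately show ?thesis by (simp only:)
    qed
    have h: "integrable lebesgue ?h" by simp
    have i: "integrable lebesgue ?k"
    proof (rule Bochner_Integration.integrable_bound[OF h])
      show "AE x in lebesgue. norm (?k x) \<le> norm (?h x)"
        using order_trans[OF le abs_ge_self]
        by (intro AE_I2) (simp only: real_norm_def abs_of_nonneg[OF powr_ge_zero])
    qed measurable
    have "(LINT x|lebesgue. ?k x) \<le> (LINT x|lebesgue. ?h x)"
      using le by (intro integral_mono i h)
    also have "\<dots> = (A powr (p - 1) * B) powr (q / p) *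
        ((1 - 1/p) * ((LINT x|lebesgue. \<bar>f x\<bar> powr q) / A powr q) + 1/p * ((LINT x|lebesgue. \<bar>g x\<bar> powr q) / B powr q))"
      by simp
    also have "\<dots> \<le> (A powr (p - 1) * B) powr (q / p) * ((1 - 1/p) * 1 + 1/p * 1)"
      using that q p Lq_norm_le_iff[of q A f] Lq_norm_le_iff[of q B g]
      by (intro mult_left_mono add_mono) (auto simp: divide_simps)
    finally show ?thesis using i by auto
  qed
  show in_Lq: "in_Lq (q / p) (\<lambda>x. \<bar>f x\<bar> powr (p - 1) * g x)"
    using bound[of "Lq_norm q f + 1" "Lq_norm q g + 1"] by (auto simp: add_nonneg_pos in_Lq_def)
  \<comment> \<open>The slack \<open>e\<close> now enters through a power, so it is removed by
    continuity as \<open>e\<close> decreases to 0 instead of by an additive epsilon.\<close>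
  show "Lq_norm (q / p) (\<lambda>x. \<bar>f x\<bar> powr (p - 1) * g x) \<le> Lq_norm q f powr (p - 1) * Lq_norm q g"
  proof (rule tendsto_lowerbound)
    have add: "((\<lambda>e. c + e) \<longlongrightarrow> c) (at_right 0)" for c :: real
      using tendsto_add[OF tendsto_const[of c] tendsto_ident_at[of 0 "{0<..}"]] by simp
    have "\<forall>\<^sub>F e in at_right 0. 0 \<le> Lq_norm q f + e"
      using eventually_at_right_less[of 0] by eventually_elim simp
    then show "((\<lambda>e. (Lq_norm q f + e) powr (p - 1) * (Lq_norm q g + e)) \<longlongrightarrow>
        Lq_norm q f powr (p - 1) * Lq_norm q g) (at_right 0)"
      using p by (intro tendsto_mult tendsto_powr2 add tendsto_const) auto
    show "\<forall>\<^sub>F e in at_right 0. Lq_norm (q / p) (\<lambda>x. \<bar>f x\<bar> powr (p - 1) * g x)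
        \<le> (Lq_norm q f + e) powr (p - 1) * (Lq_norm q g + e)"
      using eventually_at_right_less[of 0]
    proof eventually_elim
      case (elim e)
      then show ?case
        using bound[of "Lq_norm q f + e" "Lq_norm q g + e"] p q
          Lq_norm_le_iff[of "q / p" "(Lq_norm q f + e) powr (p - 1) * (Lq_norm q g + e)"
            "\<lambda>x. \<bar>f x\<bar> powr (p - 1) * g x"]
        by (simp add: add_nonneg_pos)
    qed
  qed (rule trivial_limit_at_right_real)
qed

section \<open>The heat kernel and the smoothing estimate\<close>

lemma heat_kernel_nonneg [simp]: "heat_kernel x t \<ge> 0"
  by (simp add: heat_kernel_def)

lemma heat_kernel_le:
  fixes x :: "real ^ 'n"
  assumes "t > 0"
  shows "heat_kernel x t \<le> (4 * pi * t) powr (- (real CARD('n) / 2))"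
  unfolding heat_kernel_def using assms by (intro mult_left_le) auto

lemma heat_kernel_commute: "heat_kernel (x - y) t = heat_kernel (y - x) t"
  by (simp add: heat_kernel_def norm_minus_commute)

lemma heat_kernel_measurable [measurable]:
  "(\<lambda>x :: real ^ 'n. heat_kernel x t) \<in> borel_measurable borel"
  unfolding heat_kernel_def by measurable

text \<open>G(x - y, t) as a function of y is the Gaussian density with mean x and variance 2t in
  each coordinate; its total mass 1 then follows coordinate by coordinate.\<close>

lemma heat_kernel_eq_prod_normal_density:
  fixes x y :: "real ^ 'n"
  assumes "t > 0"
  shows "heat_kernel (x - y) t = (\<Prod>b\<in>Basis. normal_density (x \<bullet> b) (sqrt (2 * t)) (y \<bullet> b))"
proof -
  have "(norm (x - y))\<^sup>2 = (\<Sum>b\<in>Basis. (y \<bullet> b - x \<bullet> b)\<^sup>2)"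
    unfolding power2_norm_eq_inner euclidean_inner[of "x - y" "x - y"]
    by (intro sum.cong) (auto simp: inner_diff_left power2_eq_square algebra_simps)
  then have "- ((norm (x - y))\<^sup>2 / (4 * t)) = (\<Sum>b\<in>Basis. - ((y \<bullet> b - x \<bullet> b)\<^sup>2 / (4 * t)))"
    by (simp only: sum_negf sum_divide_distrib)
  then have exp: "exp (- ((norm (x - y))\<^sup>2 / (4 * t))) = (\<Prod>b\<in>Basis. exp (- ((y \<bullet> b - x \<bullet> b)\<^sup>2 / (4 * t))))"
    by (simp only: exp_sum[where f = "\<lambda>b. - ((y \<bullet> b - x \<bullet> b)\<^sup>2 / (4 * t))", OF finite_Basis])
  have pow: "(1 / sqrt (4 * pi * t)) ^ CARD('n) = (4 * pi * t) powr (- (real CARD('n) / 2))"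
  proof -
    have "1 / sqrt (4 * pi * t) = (4 * pi * t) powr (- (1/2))"
      using assms powr_half_sqrt[of "4 * pi * t"] by (simp only: powr_minus_divide) simp
    then show ?thesis
      using assms powr_realpow[of "(4 * pi * t) powr (- (1/2))" "CARD('n)"] by (simp only: powr_powr) simp
  qed
  have "normal_density (x \<bullet> b) (sqrt (2 * t)) (y \<bullet> b)
      = 1 / sqrt (4 * pi * t) * exp (- ((y \<bullet> b - x \<bullet> b)\<^sup>2 / (4 * t)))" for b
    using assms by (simp add: normal_density_def)
  then show ?thesis
    by (simp only: prod.distrib heat_kernel_def exp flip: pow) simp
qed

lemma nn_integral_heat_kernel:
  fixes x :: "real ^ 'n"
  assumes "t > 0"
  shows "(\<integral>\<^sup>+y. ennreal (heat_kernel (x - y) t) \<partial>lborel) = 1"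
proof -
  have 1: "(\<integral>\<^sup>+y. ennreal (normal_density m (sqrt (2 * t)) y) \<partial>lborel) = 1" for m
    using assms by (simp add: nn_integral_eq_integral)
  have "(\<integral>\<^sup>+y. ennreal (heat_kernel (x - y) t) \<partial>lborel) =
      (\<integral>\<^sup>+y. (\<Prod>b\<in>Basis. ennreal (normal_density (x \<bullet> b) (sqrt (2 * t)) (y \<bullet> b))) \<partial>lborel)"
    using assms by (simp add: heat_kernel_eq_prod_normal_density prod_ennreal)
  also have "\<dots> = (\<Prod>b\<in>Basis. (\<integral>\<^sup>+y. ennreal (normal_density (x \<bullet> b) (sqrt (2 * t)) y) \<partial>lborel))"
    by (intro nn_integral_lborel_prod) auto
  finally show ?thesis by (simp add: 1)
qed

lemma integrable_heat_kernel:
  fixes x :: "real ^ 'n"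
  assumes "t > 0"
  shows "integrable lborel (\<lambda>y. heat_kernel (x - y) t)" "(LINT y|lborel. heat_kernel (x - y) t) = 1"
  using nn_integral_heat_kernel[OF assms, of x]
  by (auto intro!: integrableI_nonneg simp: integral_eq_nn_integral)

lemma integrable_heat_kernel_powr:
  fixes \<phi> :: "real ^ 'n \<Rightarrow> real"
  assumes "t > 0" "in_Lq r \<phi>"
  shows "integrable lebesgue (\<lambda>y. heat_kernel (x - y) t * \<bar>\<phi> y\<bar> powr r)"
proof (rule Bochner_Integration.integrable_bound)
  show "integrable lebesgue (\<lambda>y. (4 * pi * t) powr (- (real CARD('n) / 2)) * \<bar>\<phi> y\<bar> powr r)"
    using in_Lq_integrable[OF assms(2)] by simp
  have [measurable]: "(\<lambda>y. heat_kernel (x - y) t) \<in> borel_measurable lebesgue"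
    by (intro measurable_completion) simp
  show "(\<lambda>y. heat_kernel (x - y) t * \<bar>\<phi> y\<bar> powr r) \<in> borel_measurable lebesgue"
    using in_Lq_measurable[OF assms(2)] by measurable
  show "AE y in lebesgue. norm (heat_kernel (x - y) t * \<bar>\<phi> y\<bar> powr r)
      \<le> norm ((4 * pi * t) powr (- (real CARD('n) / 2)) * \<bar>\<phi> y\<bar> powr r)"
    using heat_kernel_le[OF assms(1), where 'n = 'n] by (auto simp: abs_mult intro!: mult_right_mono)
qed

text \<open>Since |s| \<le> 1 + |s|^r, the integrand is dominated by G + G |\<phi>|^r. This avoids a
  dual exponent and covers r = 1 uniformly.\<close>

lemma integrable_heat_kernel_mult:
  fixes \<phi> :: "real ^ 'n \<Rightarrow> real"
  assumes "t > 0" "r \<ge> 1" "in_Lq r \<phi>"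
  shows "integrable lebesgue (\<lambda>y. heat_kernel (x - y) t * \<phi> y)"
proof (rule Bochner_Integration.integrable_bound)
  have K: "integrable lebesgue (\<lambda>y. heat_kernel (x - y) t)"
    using integrable_heat_kernel[OF assms(1)] by (simp add: integrable_completion)
  show "integrable lebesgue (\<lambda>y. heat_kernel (x - y) t + heat_kernel (x - y) t * \<bar>\<phi> y\<bar> powr r)"
    by (intro Bochner_Integration.integrable_add K integrable_heat_kernel_powr assms)
  show "(\<lambda>y. heat_kernel (x - y) t * \<phi> y) \<in> borel_measurable lebesgue"
    using in_Lq_measurable[OF assms(3)] borel_measurable_integrable[OF K] by measurable
  have "\<bar>\<phi> y\<bar> \<le> 1 + \<bar>\<phi> y\<bar> powr r" for y
  proof (cases "\<bar>\<phi> y\<bar> \<le> 1")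
    case False
    then have "\<bar>\<phi> y\<bar> powr 1 \<le> \<bar>\<phi> y\<bar> powr r" using assms by (intro powr_mono) auto
    then show ?thesis using False by simp
  qed (simp add: add_increasing2)
  then have "heat_kernel (x - y) t * \<bar>\<phi> y\<bar> \<le> heat_kernel (x - y) t * (1 + \<bar>\<phi> y\<bar> powr r)" for y
    by (intro mult_left_mono) auto
  then show "AE y in lebesgue. norm (heat_kernel (x - y) t * \<phi> y)
      \<le> norm (heat_kernel (x - y) t + heat_kernel (x - y) t * \<bar>\<phi> y\<bar> powr r)"
    by (intro AE_I2) (simp add: abs_mult distrib_left)
qed

text \<open>Jensen's inequality for the probability density G(x - y, t): the tangent to s^r at the
  mean \<open>m\<close> of |\<phi>| is integrated against the kernel.\<close>

lemma heat_semigroup_jensen: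
  fixes \<phi> :: "real ^ 'n \<Rightarrow> real"
  assumes "t > 0" "r \<ge> 1" "in_Lq r \<phi>"
  shows "\<bar>heat_semigroup t \<phi> x\<bar> powr r \<le> (LINT y|lebesgue. heat_kernel (x - y) t * \<bar>\<phi> y\<bar> powr r)"
proof -
  have K: "integrable lebesgue (\<lambda>y. heat_kernel (x - y) t)" "(LINT y|lebesgue. heat_kernel (x - y) t) = 1"
    using integrable_heat_kernel[OF assms(1)] by (simp_all add: integrable_completion integral_completion)
  define m where "m = (LINT y|lebesgue. heat_kernel (x - y) t * \<bar>\<phi> y\<bar>)"
  have i: "integrable lebesgue (\<lambda>y. heat_kernel (x - y) t * \<bar>\<phi> y\<bar>)"
    using integrable_abs[OF integrable_heat_kernel_mult[OF assms, of x]] by (simp add: abs_mult)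
  have "\<bar>heat_semigroup t \<phi> x\<bar> \<le> m"
    using integral_abs_bound[of lebesgue "\<lambda>y. heat_kernel (x - y) t * \<phi> y"] assms(1)
    by (simp add: heat_semigroup_def m_def abs_mult)
  then have "\<bar>heat_semigroup t \<phi> x\<bar> powr r \<le> m powr r"
    using assms by (intro powr_mono2) auto
  also have "m powr r \<le> (LINT y|lebesgue. heat_kernel (x - y) t * \<bar>\<phi> y\<bar> powr r)"
  proof (cases "m = 0")
    case True
    then show ?thesis by simp
  next
    case False
    moreover have "m \<ge> 0" by (simp add: m_def)
    ultimately have m: "m > 0" by simp
    \<comment> \<open>Mass 1 and mean \<open>m\<close> make the integrated tangent equal to its
      value m^r at the point of contact.\<close>
    have "m powr r = m powr r * (r / m * m + (1 - r) * 1)"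
      using m by simp
    also have "\<dots> = (LINT y|lebesgue. m powr r * (r / m * (heat_kernel (x - y) t * \<bar>\<phi> y\<bar>) + (1 - r) * heat_kernel (x - y) t))"
      using i K by (simp add: m_def)
    also have "\<dots> \<le> (LINT y|lebesgue. heat_kernel (x - y) t * \<bar>\<phi> y\<bar> powr r)"
    proof (intro integral_mono integrable_heat_kernel_powr assms)
      show "integrable lebesgue (\<lambda>y. m powr r * (r / m * (heat_kernel (x - y) t * \<bar>\<phi> y\<bar>) + (1 - r) * heat_kernel (x - y) t))"
        using i K by simp
      fix y
      have "heat_kernel (x - y) t * (m powr r * (r * (\<bar>\<phi> y\<bar> / m - 1) + 1)) \<le> heat_kernel (x - y) t * \<bar>\<phi> y\<bar> powr r"
        using m assms by (intro mult_left_mono powr_ge_tangent_line) auto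
      then show "m powr r * (r / m * (heat_kernel (x - y) t * \<bar>\<phi> y\<bar>) + (1 - r) * heat_kernel (x - y) t)
          \<le> heat_kernel (x - y) t * \<bar>\<phi> y\<bar> powr r"
        by (simp add: algebra_simps)
    qed
    finally show ?thesis .
  qed
  finally show ?thesis .
qed

text \<open>
  With \<open>k = G(\<cdot>,t) \<star> \<bar>\<phi>\<bar>\<^sup>r\<close>, Jensen's inequality gives \<open>\<bar>S(t)\<phi>\<bar>\<^sup>r\<^sup>p \<le> k\<^sup>p \<le> (sup k)\<^sup>p\<^sup>-\<^sup>1 k\<close>, and \<open>k\<close>
  has the integral of \<open>\<bar>\<phi>\<bar>\<^sup>r\<close>; this replaces Young's convolution inequality.
\<close>

lemma heat_semigroup_smoothing:
  fixes \<phi> :: "real ^ 'n \<Rightarrow> real"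
  assumes t: "t > 0" and r: "r \<ge> 1" and p: "p \<ge> 1" and \<phi>: "in_Lq r \<phi>"
  shows "in_Lq (r * p) (heat_semigroup t \<phi>)"
    "Lq_norm (r * p) (heat_semigroup t \<phi>) \<le>
      (4 * pi * t) powr (- (real CARD('n) * (p - 1) / (2 * (r * p)))) * Lq_norm r \<phi>"
proof -
  define c where "c = (4 * pi * t) powr (- (real CARD('n) / 2))"
  define a where "a = (LINT y|lebesgue. \<bar>\<phi> y\<bar> powr r)"
  define k where "k x = (LINT y|lebesgue. heat_kernel (x - y) t * \<bar>\<phi> y\<bar> powr r)" for x
  have c: "c > 0" using t by (simp add: c_def)
  have a: "a \<ge> 0" by (simp add: a_def)
  note [measurable] = in_Lq_measurable[OF \<phi>]
  \<comment> \<open>\<phi> is only Lebesgue measurable, whereas Fubini and measurability in the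
    parameter x need joint measurability in (x, y) over \<open>lborel\<close>; hence the Borel
    representative \<psi>.\<close>
  obtain \<psi> where \<psi> [measurable]: "\<psi> \<in> borel_measurable lborel" and AE: "AE x in lborel. \<phi> x = \<psi> x"
    using completion_ex_borel_measurable_real[OF in_Lq_measurable[OF \<phi>]] by auto
  have [measurable]: "\<psi> \<in> borel_measurable borel" using \<psi> by simp
  have AE': "AE x in lebesgue. \<phi> x = \<psi> x"
    using AE by (rule AE_completion)
  have km [measurable]: "(\<lambda>y. heat_kernel (x - y) t) \<in> borel_measurable lebesgue"
      "\<psi> \<in> borel_measurable lebesgue" for x
    by (auto intro!: measurable_completion)
  have S_eq: "heat_semigroup t \<phi> = (\<lambda>x. LINT y|lborel. heat_kernel (x - y) t * \<psi> y)"
  proof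
    fix x
    have "heat_semigroup t \<phi> x = (LINT y|lebesgue. heat_kernel (x - y) t * \<phi> y)"
      using t by (simp add: heat_semigroup_def)
    also have "\<dots> = (LINT y|lebesgue. heat_kernel (x - y) t * \<psi> y)"
      by (intro integral_cong_AE) (use AE' in auto)
    also have "\<dots> = (LINT y|lborel. heat_kernel (x - y) t * \<psi> y)"
      by (intro integral_completion) simp
    finally show "heat_semigroup t \<phi> x = (LINT y|lborel. heat_kernel (x - y) t * \<psi> y)" .
  qed
  have S_borel: "heat_semigroup t \<phi> \<in> borel_measurable borel"
    unfolding S_eq by (intro lborel.borel_measurable_lebesgue_integral) simp
  then have S_meas [measurable]: "heat_semigroup t \<phi> \<in> borel_measurable lebesgue"
    by (intro measurable_completion) simp
  have k_nn: "ennreal (k x) = (\<integral>\<^sup>+y. ennreal (heat_kernel (x - y) t * \<bar>\<psi> y\<bar> powr r) \<partial>lborel)" for x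
  proof -
    have "ennreal (k x) = (\<integral>\<^sup>+y. ennreal (heat_kernel (x - y) t * \<bar>\<phi> y\<bar> powr r) \<partial>lebesgue)"
      unfolding k_def using integrable_heat_kernel_powr[OF t \<phi>]
      by (intro nn_integral_eq_integral[symmetric]) auto
    also have "\<dots> = (\<integral>\<^sup>+y. ennreal (heat_kernel (x - y) t * \<bar>\<psi> y\<bar> powr r) \<partial>lebesgue)"
      by (intro nn_integral_cong_AE) (use AE' in eventually_elim, simp)
    finally show ?thesis by (simp add: nn_integral_completion)
  qed
  have a_nn: "ennreal a = (\<integral>\<^sup>+y. ennreal (\<bar>\<psi> y\<bar> powr r) \<partial>lborel)"
  proof -
    have "ennreal a = (\<integral>\<^sup>+y. ennreal (\<bar>\<phi> y\<bar> powr r) \<partial>lebesgue)"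
      unfolding a_def using in_Lq_integrable[OF \<phi>]
      by (intro nn_integral_eq_integral[symmetric]) auto
    also have "\<dots> = (\<integral>\<^sup>+y. ennreal (\<bar>\<psi> y\<bar> powr r) \<partial>lebesgue)"
      by (intro nn_integral_cong_AE) (use AE' in eventually_elim, simp)
    finally show ?thesis by (simp add: nn_integral_completion)
  qed
  have k_int: "(\<integral>\<^sup>+x. ennreal (k x) \<partial>lborel) = ennreal a"
  proof -
    have "(\<integral>\<^sup>+x. ennreal (k x) \<partial>lborel) =
        (\<integral>\<^sup>+x. \<integral>\<^sup>+y. ennreal (heat_kernel (x - y) t * \<bar>\<psi> y\<bar> powr r) \<partial>lborel \<partial>lborel)"
      by (simp add: k_nn)
    also have "\<dots> = (\<integral>\<^sup>+y. \<integral>\<^sup>+x. ennreal (heat_kernel (x - y) t * \<bar>\<psi> y\<bar> powr r) \<partial>lborel \<partial>lborel)"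
      by (intro lborel_pair.Fubini') simp
    also have "\<dots> = (\<integral>\<^sup>+y. (\<integral>\<^sup>+x. ennreal (heat_kernel (y - x) t) \<partial>lborel) * ennreal (\<bar>\<psi> y\<bar> powr r) \<partial>lborel)"
      by (intro nn_integral_cong) (subst heat_kernel_commute, simp add: ennreal_mult nn_integral_multc)
    finally show ?thesis by (simp add: nn_integral_heat_kernel t a_nn)
  qed
  have k_le: "k x \<le> c * a" for x
  proof -
    have "k x \<le> (LINT y|lebesgue. c * \<bar>\<phi> y\<bar> powr r)"
      unfolding k_def c_def using heat_kernel_le[OF t, where 'n = 'n] in_Lq_integrable[OF \<phi>]
      by (intro integral_mono integrable_heat_kernel_powr t \<phi>) (auto intro!: mult_right_mono)
    then show ?thesis by (simp add: a_def)
  qed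
  have k_nonneg: "k x \<ge> 0" for x by (simp add: k_def)
  have bound: "\<bar>heat_semigroup t \<phi> x\<bar> powr (r * p) \<le> (c * a) powr (p - 1) * k x" for x
  proof -
    have "\<bar>heat_semigroup t \<phi> x\<bar> powr (r * p) = (\<bar>heat_semigroup t \<phi> x\<bar> powr r) powr p"
      by (simp add: powr_powr)
    also have "\<dots> \<le> k x powr p"
      unfolding k_def using p by (intro powr_mono2 heat_semigroup_jensen t r \<phi>) auto
    also have "\<dots> = k x powr (p - 1) * k x"
      using k_nonneg[of x] by (cases "k x = 0") (auto simp: powr_diff)
    also have "\<dots> \<le> (c * a) powr (p - 1) * k x"
      using p k_le[of x] k_nonneg[of x] by (intro mult_right_mono powr_mono2) auto
    finally show ?thesis .
  qed
  have "(\<integral>\<^sup>+x. ennreal (\<bar>heat_semigroup t \<phi> x\<bar> powr (r * p)) \<partial>lebesgue)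
      \<le> (\<integral>\<^sup>+x. ennreal ((c * a) powr (p - 1)) * ennreal (k x) \<partial>lborel)"
    unfolding nn_integral_completion
    using bound by (intro nn_integral_mono) (simp add: k_nonneg flip: ennreal_mult)
  also have "\<dots> = ennreal ((c * a) powr (p - 1)) * ennreal a"
    unfolding k_int[symmetric]
    by (rule nn_integral_cmult) (simp add: k_nn lborel.borel_measurable_nn_integral)
  also have "\<dots> = ennreal ((c * a) powr (p - 1) * a)"
    using a by (simp add: ennreal_mult)
  finally have nn: "(\<integral>\<^sup>+x. ennreal (\<bar>heat_semigroup t \<phi> x\<bar> powr (r * p)) \<partial>lebesgue)
      \<le> ennreal ((c * a) powr (p - 1) * a)" .
  have int: "integrable lebesgue (\<lambda>x. \<bar>heat_semigroup t \<phi> x\<bar> powr (r * p))"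
    using le_less_trans[OF nn ennreal_less_top] by (intro integrableI_nonneg) auto
  then show "in_Lq (r * p) (heat_semigroup t \<phi>)"
    by (simp add: in_Lq_def)
  have "(LINT x|lebesgue. \<bar>heat_semigroup t \<phi> x\<bar> powr (r * p)) \<le> (c * a) powr (p - 1) * a"
    using nn a unfolding nn_integral_eq_integral[OF int, simplified] by simp
  also have "\<dots> = c powr (p - 1) * a powr p"
    using a c by (cases "a = 0") (auto simp: powr_mult powr_diff)
  \<comment> \<open>As \<open>a\<close> is the r-th power of the norm of \<phi>, a^p is its (r p)-th
    power. The (r p)-th root then turns c^(p-1) = (4 pi t)^(-N(p-1)/2) into the claimed power of
    t.\<close>
  also have "\<dots> = (c powr ((p - 1) / (r * p)) * Lq_norm r \<phi>) powr (r * p)"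
  proof -
    have "a powr p = Lq_norm r \<phi> powr (r * p)"
      using r Lq_norm_powr[of r \<phi>] by (simp add: a_def flip: powr_powr)
    then show ?thesis
      using r p by (simp add: powr_mult powr_powr)
  qed
  finally have "Lq_norm (r * p) (heat_semigroup t \<phi>) \<le> c powr ((p - 1) / (r * p)) * Lq_norm r \<phi>"
    using r p by (subst Lq_norm_le_iff) auto
  also have "c powr ((p - 1) / (r * p)) = (4 * pi * t) powr (- (real CARD('n) * (p - 1) / (2 * (r * p))))"
    by (simp add: c_def powr_powr)
  finally show "Lq_norm (r * p) (heat_semigroup t \<phi>) \<le>
      (4 * pi * t) powr (- (real CARD('n) * (p - 1) / (2 * (r * p)))) * Lq_norm r \<phi>" .
qed

section \<open>The nonlinear term as a map from L^q to L^(q/p)\<close>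

lemma Lq_norm_abs_powr:
  assumes "p > 0" "in_Lq q f"
  shows "in_Lq (q / p) (\<lambda>x. \<bar>f x\<bar> powr p)"
    "Lq_norm (q / p) (\<lambda>x. \<bar>f x\<bar> powr p) = Lq_norm q f powr p"
  using assms by (auto simp: in_Lq_def Lq_norm_def powr_powr)

text \<open>With a and b the norms of f and g, the difference is split as a^\<alpha> (|f|^p - |g|^p)
  + (a^\<alpha> - b^\<alpha>) |g|^p; the two summands of the constant bound these parts. The second
  one uses \<alpha> \<ge> 1, which makes s^\<alpha> Lipschitz on bounded sets.\<close>

lemma Lq_nonlinearity_lipschitz:
  fixes f g :: "real ^ 'n \<Rightarrow> real"
  assumes p: "p > 1" and q: "q \<ge> p" and \<alpha>: "\<alpha> \<ge> 1"
    and f: "in_Lq q f" "Lq_norm q f \<le> M" and g: "in_Lq q g" "Lq_norm q g \<le> M"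
  shows "Lq_dist (q / p) (\<lambda>x. Lq_norm q f powr \<alpha> * \<bar>f x\<bar> powr p) (\<lambda>x. Lq_norm q g powr \<alpha> * \<bar>g x\<bar> powr p)
    \<le> (M powr \<alpha> * (p * (2 * M) powr (p - 1)) + \<alpha> * (2 * M) powr (\<alpha> - 1) * M powr p) * Lq_dist q f g"
proof -
  define a b where "a = Lq_norm q f" and "b = Lq_norm q g"
  have ab: "0 \<le> a" "a \<le> M" "0 \<le> b" "b \<le> M" using f g by (auto simp: a_def b_def)
  have q1: "q \<ge> 1" "q > 0" "q / p \<ge> 1" "q / p > 0" using p q by (auto simp: field_simps)
  have d: "in_Lq q (\<lambda>x. f x - g x)" by (intro in_Lq_diff q1 f g)
  have abs: "in_Lq q (\<lambda>x. \<bar>f x\<bar>)" "in_Lq q (\<lambda>x. \<bar>g x\<bar>)"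
    using f g by (auto simp: in_Lq_def)
  have s: "in_Lq q (\<lambda>x. \<bar>f x\<bar> + \<bar>g x\<bar>)" "Lq_norm q (\<lambda>x. \<bar>f x\<bar> + \<bar>g x\<bar>) \<le> 2 * M"
    using Lq_norm_add[OF q1(1) abs] f g by (auto simp: Lq_norm_def)
  \<comment> \<open>The pointwise majorant of |f|^p - |g|^p from \<open>abs_powr_diff_le\<close>;
    the outer absolute value is there to match the form of \<open>Lq_norm_powr_mult\<close>.\<close>
  define k where "k x = p * (\<bar>\<bar>f x\<bar> + \<bar>g x\<bar>\<bar> powr (p - 1) * (f x - g x))" for x
  have k: "in_Lq (q / p) k"
    unfolding k_def by (intro in_Lq_cmult Lq_norm_powr_mult p q1 s d)
  have k_norm: "Lq_norm (q / p) k \<le> p * ((2 * M) powr (p - 1) * Lq_dist q f g)"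
  proof -
    have "Lq_norm (q / p) k = p * Lq_norm (q / p) (\<lambda>x. \<bar>\<bar>f x\<bar> + \<bar>g x\<bar>\<bar> powr (p - 1) * (f x - g x))"
      unfolding k_def using p q1 by (subst Lq_norm_cmult) auto
    also have "\<dots> \<le> p * (Lq_norm q (\<lambda>x. \<bar>f x\<bar> + \<bar>g x\<bar>) powr (p - 1) * Lq_norm q (\<lambda>x. f x - g x))"
      using p by (intro mult_left_mono Lq_norm_powr_mult q1 s d) auto
    also have "\<dots> \<le> p * ((2 * M) powr (p - 1) * Lq_norm q (\<lambda>x. f x - g x))"
      using p s by (intro mult_left_mono mult_right_mono powr_mono2) auto
    finally show ?thesis by (simp add: Lq_dist_def)
  qed
  note fp = Lq_norm_abs_powr[of p q f, OF _ f(1)] and gp = Lq_norm_abs_powr[of p q g, OF _ g(1)]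
  have h: "in_Lq (q / p) (\<lambda>x. \<bar>f x\<bar> powr p - \<bar>g x\<bar> powr p)"
    using p by (intro in_Lq_diff q1 fp gp) auto
  have "Lq_norm (q / p) (\<lambda>x. \<bar>f x\<bar> powr p - \<bar>g x\<bar> powr p) \<le> Lq_norm (q / p) k"
  proof (rule Lq_norm_AE_mono(2)[OF q1(4) in_Lq_measurable[OF h] k])
    have "\<bar>\<bar>f x\<bar> powr p - \<bar>g x\<bar> powr p\<bar> \<le> \<bar>k x\<bar>" for x
    proof -
      have "\<bar>\<bar>f x\<bar> powr p - \<bar>g x\<bar> powr p\<bar> \<le> p * (\<bar>f x\<bar> + \<bar>g x\<bar>) powr (p - 1) * \<bar>\<bar>f x\<bar> - \<bar>g x\<bar>\<bar>"
        using p by (intro abs_powr_diff_le) auto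
      also have "\<dots> \<le> p * (\<bar>f x\<bar> + \<bar>g x\<bar>) powr (p - 1) * \<bar>f x - g x\<bar>"
        using p by (intro mult_left_mono) auto
      finally show ?thesis using p by (simp add: k_def abs_mult mult.assoc)
    qed
    then show "AE x in lebesgue. \<bar>\<bar>f x\<bar> powr p - \<bar>g x\<bar> powr p\<bar> \<le> \<bar>k x\<bar>" by simp
  qed
  with k_norm have h_norm: "Lq_norm (q / p) (\<lambda>x. \<bar>f x\<bar> powr p - \<bar>g x\<bar> powr p) \<le> p * ((2 * M) powr (p - 1) * Lq_dist q f g)"
    by simp
  have norm_diff: "\<bar>a powr \<alpha> - b powr \<alpha>\<bar> \<le> \<alpha> * (2 * M) powr (\<alpha> - 1) * Lq_dist q f g"
  proof -
    have "\<bar>a powr \<alpha> - b powr \<alpha>\<bar> \<le> \<alpha> * (a + b) powr (\<alpha> - 1) * \<bar>a - b\<bar>"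
      using \<alpha> ab by (intro abs_powr_diff_le) auto
    also have "\<dots> \<le> \<alpha> * (2 * M) powr (\<alpha> - 1) * Lq_dist q f g"
      using \<alpha> ab abs_Lq_norm_diff_le[OF q1(1) f(1) g(1)]
      by (intro mult_mono powr_mono2) (auto simp: a_def b_def)
    finally show ?thesis .
  qed
  let ?h1 = "\<lambda>x. a powr \<alpha> * (\<bar>f x\<bar> powr p - \<bar>g x\<bar> powr p)"
  let ?h2 = "\<lambda>x. (a powr \<alpha> - b powr \<alpha>) * \<bar>g x\<bar> powr p"
  have "Lq_dist (q / p) (\<lambda>x. a powr \<alpha> * \<bar>f x\<bar> powr p) (\<lambda>x. b powr \<alpha> * \<bar>g x\<bar> powr p)
      = Lq_norm (q / p) (\<lambda>x. ?h1 x + ?h2 x)"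
    unfolding Lq_dist_def by (intro arg_cong[where f = "Lq_norm (q / p)"]) (auto simp: algebra_simps)
  also have "\<dots> \<le> Lq_norm (q / p) ?h1 + Lq_norm (q / p) ?h2"
    using p by (intro Lq_norm_add in_Lq_cmult h gp q1) auto
  also have "Lq_norm (q / p) ?h1 = a powr \<alpha> * Lq_norm (q / p) (\<lambda>x. \<bar>f x\<bar> powr p - \<bar>g x\<bar> powr p)"
    using q1 by (subst Lq_norm_cmult) auto
  also have "Lq_norm (q / p) ?h2 = \<bar>a powr \<alpha> - b powr \<alpha>\<bar> * b powr p"
    using q1 p gp(2) by (subst Lq_norm_cmult) (auto simp: b_def)
  also have "a powr \<alpha> * Lq_norm (q / p) (\<lambda>x. \<bar>f x\<bar> powr p - \<bar>g x\<bar> powr p) \<le>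
      M powr \<alpha> * (p * ((2 * M) powr (p - 1) * Lq_dist q f g))"
    using ab \<alpha> h_norm by (intro mult_mono powr_mono2) auto
  also have "\<bar>a powr \<alpha> - b powr \<alpha>\<bar> * b powr p \<le> \<alpha> * (2 * M) powr (\<alpha> - 1) * Lq_dist q f g * M powr p"
    using ab \<alpha> p norm_diff by (intro mult_mono powr_mono2) auto
  finally show ?thesis
    by (simp add: a_def b_def algebra_simps)
qed

lemma heat_semigroup_diff:
  fixes \<phi> \<psi> :: "real ^ 'n \<Rightarrow> real"
  assumes "t > 0" "r \<ge> 1" "in_Lq r \<phi>" "in_Lq r \<psi>"
  shows "heat_semigroup t \<phi> x - heat_semigroup t \<psi> x = heat_semigroup t (\<lambda>y. \<phi> y - \<psi> y) x"
  using assms integrable_heat_kernel_mult[OF assms(1-3), of x] integrable_heat_kernel_mult[OF assms(1,2,4), of x]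
  by (simp add: heat_semigroup_def right_diff_distrib)

section \<open>Comparing Bochner integrals in L^q\<close>

text \<open>The values of \<open>z\<close> may be functions or pairs of functions. With
  \<open>h\<close> evaluation at a point, the sum is the value of \<open>Lq_simple_integral\<close>
  there; with \<open>h\<close> a distance, it is a time integral of norms. Both thus become ordinary
  real integrals.\<close>

lemma simple_function_integral_eq_sum:
  fixes h :: "'c \<Rightarrow> real"
  assumes z: "simple_function (lebesgue_on {a..b :: real}) z"
  shows "integrable (lebesgue_on {a..b}) (\<lambda>\<tau>. h (z \<tau>))"
    "(LINT \<tau>|lebesgue_on {a..b}. h (z \<tau>)) = (\<Sum>c\<in>z ` {a..b}. measure lebesgue {\<tau>\<in>{a..b}. z \<tau> = c} * h c)"
proof -
  let ?M = "lebesgue_on {a..b}"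
  let ?A = "\<lambda>c. {\<tau>\<in>{a..b}. z \<tau> = c}"
  let ?g = "\<lambda>\<tau>. \<Sum>c\<in>z ` {a..b}. indicat_real (?A c) \<tau> * h c"
  have fin: "finite (z ` {a..b})" using simple_functionD(1)[OF z] by simp
  have sets: "?A c \<in> sets ?M" for c
  proof -
    have "?A c = z -` {c} \<inter> space ?M" by auto
    then show ?thesis using simple_functionD(2)[OF z] by metis
  qed
  have meas: "emeasure ?M (?A c) < \<infinity>" "measure ?M (?A c) = measure lebesgue (?A c)" for c
  proof -
    have "emeasure ?M (?A c) \<le> emeasure ?M (space ?M)" by (rule emeasure_space)
    also have "\<dots> < \<infinity>"
      using emeasure_lborel_cbox_finite[of a b] by (simp add: emeasure_restrict_space)
    finally show "emeasure ?M (?A c) < \<infinity>" .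
    show "measure ?M (?A c) = measure lebesgue (?A c)"
      by (rule measure_restrict_space) auto
  qed
  have int: "integrable ?M (indicat_real (?A c))" for c
    using sets meas by (intro integrable_real_indicator)
  have eq: "h (z \<tau>) = ?g \<tau>" if "\<tau> \<in> space ?M" for \<tau>
  proof -
    have "?g \<tau> = (\<Sum>c\<in>z ` {a..b}. if c = z \<tau> then h c else 0)"
      using that by (intro sum.cong) (auto simp: indicator_def)
    also have "\<dots> = h (z \<tau>)"
      using fin that by (subst sum.delta) auto
    finally show ?thesis by simp
  qed
  have g: "integrable ?M ?g"
    by (intro Bochner_Integration.integrable_sum integrable_mult_left int)
  show "integrable ?M (\<lambda>\<tau>. h (z \<tau>))"
    using g eq by (subst Bochner_Integration.integrable_cong[OF refl]) auto
  have "(LINT \<tau>|?M. h (z \<tau>)) = (LINT \<tau>|?M. ?g \<tau>)"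
    using eq by (intro Bochner_Integration.integral_cong) auto
  also have "\<dots> = (\<Sum>c\<in>z ` {a..b}. measure lebesgue (?A c) * h c)"
  proof -
    have "?A c \<inter> {a..b} = ?A c" for c by auto
    then show ?thesis
      using int meas(2) by (subst Bochner_Integration.integral_sum) simp_all
  qed
  finally show "(LINT \<tau>|?M. h (z \<tau>)) = (\<Sum>c\<in>z ` {a..b}. measure lebesgue (?A c) * h c)" .
qed

lemma Lq_simple_integral_in_Lq:
  fixes s :: "real \<Rightarrow> real ^ 'n \<Rightarrow> real"
  assumes q: "q \<ge> 1" and s: "Lq_simple q a b s"
  shows "in_Lq q (Lq_simple_integral a b s)"
proof -
  have "finite (s ` {a..b})"
    using s simple_functionD(1)[of "lebesgue_on {a..b}" s] by (simp add: Lq_simple_def)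
  then show ?thesis
    unfolding Lq_simple_integral_def
    using s by (intro Lq_norm_sum[OF q, THEN conjunct1] in_Lq_cmult) (auto simp: Lq_simple_def)
qed

lemma Lq_dist_simple_integral_le:
  fixes s r :: "real \<Rightarrow> real ^ 'n \<Rightarrow> real"
  assumes q: "q \<ge> 1" and s: "Lq_simple q a b s" and r: "Lq_simple q a b r"
  shows "ennreal (Lq_dist q (Lq_simple_integral a b s) (Lq_simple_integral a b r))
    \<le> (\<integral>\<^sup>+\<tau>. ennreal (Lq_dist q (s \<tau>) (r \<tau>)) \<partial>lebesgue_on {a..b})"
proof -
  let ?M = "lebesgue_on {a..b}"
  \<comment> \<open>Pairing gives the common refinement of the two partitions of [a,b] into level
    sets.\<close>
  define z where "z \<tau> = (s \<tau>, r \<tau>)" for \<tau>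
  define m where "m c = measure lebesgue {\<tau>\<in>{a..b}. z \<tau> = c}" for c
  have sf: "simple_function ?M s" "simple_function ?M r" using s r by (auto simp: Lq_simple_def)
  then have z: "simple_function ?M z" unfolding z_def by simp
  have fin: "finite (z ` {a..b})" using simple_functionD(1)[OF z] by simp
  have in_Lq: "in_Lq q (\<lambda>x. fst c x - snd c x)" if "c \<in> z ` {a..b}" for c
    using that s r by (auto simp: z_def Lq_simple_def intro!: in_Lq_diff q)
  have "Lq_simple_integral a b s x - Lq_simple_integral a b r x = (\<Sum>c\<in>z ` {a..b}. m c * (fst c x - snd c x))" for x
  proof -
    have "Lq_simple_integral a b s x - Lq_simple_integral a b r x = (LINT \<tau>|?M. s \<tau> x) - (LINT \<tau>|?M. r \<tau> x)"
      using simple_function_integral_eq_sum(2)[OF sf(1), of "\<lambda>\<phi>. \<phi> x"]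
        simple_function_integral_eq_sum(2)[OF sf(2), of "\<lambda>\<phi>. \<phi> x"]
      by (simp add: Lq_simple_integral_def)
    also have "\<dots> = (LINT \<tau>|?M. s \<tau> x - r \<tau> x)"
      using simple_function_integral_eq_sum(1)[OF sf(1), of "\<lambda>\<phi>. \<phi> x"]
        simple_function_integral_eq_sum(1)[OF sf(2), of "\<lambda>\<phi>. \<phi> x"] by simp
    also have "\<dots> = (\<Sum>c\<in>z ` {a..b}. m c * (fst c x - snd c x))"
      using simple_function_integral_eq_sum(2)[OF z, of "\<lambda>c. fst c x - snd c x"]
      by (simp add: z_def m_def)
    finally show ?thesis .
  qed
  then have "Lq_dist q (Lq_simple_integral a b s) (Lq_simple_integral a b r)
      = Lq_norm q (\<lambda>x. \<Sum>c\<in>z ` {a..b}. m c * (fst c x - snd c x))"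
    by (simp add: Lq_dist_def)
  also have "\<dots> \<le> (\<Sum>c\<in>z ` {a..b}. Lq_norm q (\<lambda>x. m c * (fst c x - snd c x)))"
    using in_Lq by (intro Lq_norm_sum[OF q fin, THEN conjunct2] in_Lq_cmult) auto
  also have "\<dots> = (\<Sum>c\<in>z ` {a..b}. m c * Lq_dist q (fst c) (snd c))"
    using q by (intro sum.cong refl) (subst Lq_norm_cmult, auto simp: m_def Lq_dist_def)
  also have "\<dots> = (LINT \<tau>|?M. Lq_dist q (s \<tau>) (r \<tau>))"
    using simple_function_integral_eq_sum(2)[OF z, of "\<lambda>c. Lq_dist q (fst c) (snd c)"]
    by (simp add: z_def m_def)
  finally have "ennreal (Lq_dist q (Lq_simple_integral a b s) (Lq_simple_integral a b r))
      \<le> ennreal (LINT \<tau>|?M. Lq_dist q (s \<tau>) (r \<tau>))"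
    by (rule ennreal_leI)
  also have "\<dots> = (\<integral>\<^sup>+\<tau>. ennreal (Lq_dist q (s \<tau>) (r \<tau>)) \<partial>?M)"
    using simple_function_integral_eq_sum(1)[OF z, of "\<lambda>c. Lq_dist q (fst c) (snd c)"]
    by (intro nn_integral_eq_integral[symmetric]) (auto simp: z_def)
  finally show ?thesis .
qed

text \<open>By the triangle inequality the distance is almost everywhere the limit over j of the
  distances from \<open>s j\<close> to \<open>s i\<close>, which are simple in \<tau>; their liminf
  is a measurable version. Additivity of the nonnegative integral calls for such a version.\<close>

lemma Lq_dist_simple_AE_measurable:
  fixes f :: "real \<Rightarrow> real ^ 'n \<Rightarrow> real"
  assumes q: "q \<ge> 1" and s: "\<And>i::nat. Lq_simple q a b (s i)"
    and f: "AE \<tau> in lebesgue_on {a..b}. in_Lq q (f \<tau>)"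
    and lim: "AE \<tau> in lebesgue_on {a..b}. (\<lambda>i. Lq_dist q (f \<tau>) (s i \<tau>)) \<longlonglongrightarrow> 0"
  obtains D where "D \<in> borel_measurable (lebesgue_on {a..b})"
    "AE \<tau> in lebesgue_on {a..b}. ennreal (Lq_dist q (f \<tau>) (s i \<tau>)) = D \<tau>"
proof
  let ?D = "\<lambda>\<tau>. liminf (\<lambda>j. ennreal (Lq_dist q (s j \<tau>) (s i \<tau>)))"
  have "(\<lambda>\<tau>. ennreal (Lq_dist q (s j \<tau>) (s i \<tau>))) \<in> borel_measurable (lebesgue_on {a..b})" for j
    using s[of j] s[of i]
    by (intro borel_measurable_simple_function
        simple_function_compose2[where h = "\<lambda>\<phi> \<psi>. ennreal (Lq_dist q \<phi> \<psi>)"]) (simp_all add: Lq_simple_def)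
  then show "?D \<in> borel_measurable (lebesgue_on {a..b})"
    by (intro borel_measurable_liminf)
  show "AE \<tau> in lebesgue_on {a..b}. ennreal (Lq_dist q (f \<tau>) (s i \<tau>)) = ?D \<tau>"
    using f lim AE_space
  proof eventually_elim
    case (elim \<tau>)
    then have \<tau>: "in_Lq q (s j \<tau>)" for j using s by (auto simp: Lq_simple_def)
    have "(\<lambda>j. Lq_dist q (s j \<tau>) (s i \<tau>) - Lq_dist q (f \<tau>) (s i \<tau>)) \<longlonglongrightarrow> 0"
    proof (rule Lim_null_comparison[OF _ elim(2)], intro always_eventually allI)
      fix j
      show "norm (Lq_dist q (s j \<tau>) (s i \<tau>) - Lq_dist q (f \<tau>) (s i \<tau>)) \<le> Lq_dist q (f \<tau>) (s j \<tau>)"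
        using Lq_dist_triangle[OF q elim(1) \<tau>[of j] \<tau>[of i]] Lq_dist_triangle[OF q \<tau>[of j] elim(1) \<tau>[of i]]
          Lq_dist_commute[of q "s j \<tau>" "f \<tau>"]
        by simp
    qed
    then have "(\<lambda>j. Lq_dist q (s j \<tau>) (s i \<tau>)) \<longlonglongrightarrow> Lq_dist q (f \<tau>) (s i \<tau>)"
      by (simp add: LIM_zero_iff)
    then have "?D \<tau> = ennreal (Lq_dist q (f \<tau>) (s i \<tau>))"
      by (intro lim_imp_Liminf tendsto_ennrealI) auto
    then show ?case by simp
  qed
qed

text \<open>
  Only the bound \<open>h\<close> has to be measurable: \<open>\<tau> \<mapsto> \<parallel>f \<tau> - g \<tau>\<parallel>\<close> is never integrated itself.
\<close>

lemma has_Lq_integral_dist_le: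
  fixes f g :: "real \<Rightarrow> real ^ 'n \<Rightarrow> real"
  assumes q: "q \<ge> 1" and f: "has_Lq_integral q a b f I" and g: "has_Lq_integral q a b g J"
    and h [measurable]: "h \<in> borel_measurable (lebesgue_on {a..b})"
    and le: "AE \<tau> in lebesgue_on {a..b}. ennreal (Lq_dist q (f \<tau>) (g \<tau>)) \<le> h \<tau>"
  shows "ennreal (Lq_dist q I J) \<le> (\<integral>\<^sup>+\<tau>. h \<tau> \<partial>lebesgue_on {a..b})"
proof -
  let ?M = "lebesgue_on {a..b}"
  obtain s where s: "\<And>i::nat. Lq_simple q a b (s i)"
      "AE \<tau> in ?M. (\<lambda>i. Lq_dist q (f \<tau>) (s i \<tau>)) \<longlonglongrightarrow> 0"
      "(\<lambda>i. \<integral>\<^sup>+\<tau>. ennreal (Lq_dist q (f \<tau>) (s i \<tau>)) \<partial>?M) \<longlonglongrightarrow> 0"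
      "(\<lambda>i. Lq_dist q (Lq_simple_integral a b (s i)) I) \<longlonglongrightarrow> 0"
    using f unfolding has_Lq_integral_def by blast
  obtain r where r: "\<And>i::nat. Lq_simple q a b (r i)"
      "AE \<tau> in ?M. (\<lambda>i. Lq_dist q (g \<tau>) (r i \<tau>)) \<longlonglongrightarrow> 0"
      "(\<lambda>i. \<integral>\<^sup>+\<tau>. ennreal (Lq_dist q (g \<tau>) (r i \<tau>)) \<partial>?M) \<longlonglongrightarrow> 0"
      "(\<lambda>i. Lq_dist q (Lq_simple_integral a b (r i)) J) \<longlonglongrightarrow> 0"
    using g unfolding has_Lq_integral_def by blast
  have fL: "AE \<tau> in ?M. in_Lq q (f \<tau>)" "in_Lq q I" and gL: "AE \<tau> in ?M. in_Lq q (g \<tau>)" "in_Lq q J"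
    using f g by (auto simp: has_Lq_integral_def)
  let ?S = "\<lambda>i. Lq_simple_integral a b (s i)" and ?R = "\<lambda>i. Lq_simple_integral a b (r i)"
  \<comment> \<open>The path is I, \<open>?S i\<close>, \<open>?R i\<close>, J in L^q, and s_i, f,
    g, r_i under the integral; every term except the integral of \<open>h\<close> tends to
    0.\<close>
  let ?bound = "\<lambda>i. ennreal (Lq_dist q (?S i) I) + (\<integral>\<^sup>+\<tau>. ennreal (Lq_dist q (f \<tau>) (s i \<tau>)) \<partial>?M)
      + (\<integral>\<^sup>+\<tau>. h \<tau> \<partial>?M) + (\<integral>\<^sup>+\<tau>. ennreal (Lq_dist q (g \<tau>) (r i \<tau>)) \<partial>?M) + ennreal (Lq_dist q (?R i) J)"
  have bound: "ennreal (Lq_dist q I J) \<le> ?bound i" for i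
  proof -
    obtain D where D [measurable]: "D \<in> borel_measurable ?M"
      and D_eq: "AE \<tau> in ?M. ennreal (Lq_dist q (f \<tau>) (s i \<tau>)) = D \<tau>"
      using Lq_dist_simple_AE_measurable[OF q s(1) fL(1) s(2)] by metis
    obtain E where E [measurable]: "E \<in> borel_measurable ?M"
      and E_eq: "AE \<tau> in ?M. ennreal (Lq_dist q (g \<tau>) (r i \<tau>)) = E \<tau>"
      using Lq_dist_simple_AE_measurable[OF q r(1) gL(1) r(2)] by metis
    have SR: "in_Lq q (?S i)" "in_Lq q (?R i)"
      by (auto intro!: Lq_simple_integral_in_Lq q s r)
    have "(\<integral>\<^sup>+\<tau>. ennreal (Lq_dist q (s i \<tau>) (r i \<tau>)) \<partial>?M) \<le> (\<integral>\<^sup>+\<tau>. D \<tau> + h \<tau> + E \<tau> \<partial>?M)"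
    proof (rule nn_integral_mono_AE)
      show "AE \<tau> in ?M. ennreal (Lq_dist q (s i \<tau>) (r i \<tau>)) \<le> D \<tau> + h \<tau> + E \<tau>"
        using D_eq E_eq le fL(1) gL(1) AE_space
      proof eventually_elim
        case (elim \<tau>)
        then have L: "in_Lq q (s i \<tau>)" "in_Lq q (r i \<tau>)"
          using s(1)[of i] r(1)[of i] by (auto simp: Lq_simple_def)
        have "Lq_dist q (s i \<tau>) (r i \<tau>) \<le> Lq_dist q (f \<tau>) (s i \<tau>) + Lq_dist q (f \<tau>) (g \<tau>) + Lq_dist q (g \<tau>) (r i \<tau>)"
          using Lq_dist_triangle[OF q L(1) elim(4) L(2)] Lq_dist_triangle[OF q elim(4,5) L(2)]
            Lq_dist_commute[of q "s i \<tau>" "f \<tau>"] by simp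
        then have "ennreal (Lq_dist q (s i \<tau>) (r i \<tau>)) \<le>
            ennreal (Lq_dist q (f \<tau>) (s i \<tau>)) + ennreal (Lq_dist q (f \<tau>) (g \<tau>)) + ennreal (Lq_dist q (g \<tau>) (r i \<tau>))"
          by (simp flip: ennreal_plus add: ennreal_leI)
        also have "\<dots> \<le> D \<tau> + h \<tau> + E \<tau>"
          using elim by (intro add_mono) auto
        finally show ?case .
      qed
    qed
    also have "\<dots> = (\<integral>\<^sup>+\<tau>. D \<tau> \<partial>?M) + (\<integral>\<^sup>+\<tau>. h \<tau> \<partial>?M) + (\<integral>\<^sup>+\<tau>. E \<tau> \<partial>?M)"
      by (simp add: nn_integral_add)
    also have "(\<integral>\<^sup>+\<tau>. D \<tau> \<partial>?M) = (\<integral>\<^sup>+\<tau>. ennreal (Lq_dist q (f \<tau>) (s i \<tau>)) \<partial>?M)"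
      using D_eq by (intro nn_integral_cong_AE) auto
    also have "(\<integral>\<^sup>+\<tau>. E \<tau> \<partial>?M) = (\<integral>\<^sup>+\<tau>. ennreal (Lq_dist q (g \<tau>) (r i \<tau>)) \<partial>?M)"
      using E_eq by (intro nn_integral_cong_AE) auto
    finally have mid: "ennreal (Lq_dist q (?S i) (?R i)) \<le> (\<integral>\<^sup>+\<tau>. ennreal (Lq_dist q (f \<tau>) (s i \<tau>)) \<partial>?M)
        + (\<integral>\<^sup>+\<tau>. h \<tau> \<partial>?M) + (\<integral>\<^sup>+\<tau>. ennreal (Lq_dist q (g \<tau>) (r i \<tau>)) \<partial>?M)"
      using Lq_dist_simple_integral_le[OF q s(1) r(1), of i i] by (rule order_trans[rotated])
    have "Lq_dist q I J \<le> Lq_dist q (?S i) I + Lq_dist q (?S i) (?R i) + Lq_dist q (?R i) J"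
      using Lq_dist_triangle[OF q fL(2) SR(1) gL(2)] Lq_dist_triangle[OF q SR gL(2)]
        Lq_dist_commute[of q "?S i" I] by simp
    then have "ennreal (Lq_dist q I J) \<le> ennreal (Lq_dist q (?S i) I) + ennreal (Lq_dist q (?S i) (?R i)) + ennreal (Lq_dist q (?R i) J)"
      by (simp flip: ennreal_plus add: ennreal_leI)
    also have "\<dots> \<le> ennreal (Lq_dist q (?S i) I) + ((\<integral>\<^sup>+\<tau>. ennreal (Lq_dist q (f \<tau>) (s i \<tau>)) \<partial>?M)
        + (\<integral>\<^sup>+\<tau>. h \<tau> \<partial>?M) + (\<integral>\<^sup>+\<tau>. ennreal (Lq_dist q (g \<tau>) (r i \<tau>)) \<partial>?M)) + ennreal (Lq_dist q (?R i) J)"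
      by (intro add_mono mid order_refl)
    finally show ?thesis by (simp add: add.assoc)
  qed
  have "?bound \<longlonglongrightarrow> ennreal 0 + 0 + (\<integral>\<^sup>+\<tau>. h \<tau> \<partial>?M) + 0 + ennreal 0"
    by (intro tendsto_add tendsto_const tendsto_ennrealI s r)
  then show ?thesis
    using bound by (intro LIMSEQ_le_const) auto
qed

text \<open>For equal integrands the majorant can be taken to be 0. This is what identifies the
  forcing terms of two solutions.\<close>

lemma has_Lq_integral_unique:
  fixes f :: "real \<Rightarrow> real ^ 'n \<Rightarrow> real"
  assumes "q \<ge> 1" "has_Lq_integral q a b f I" "has_Lq_integral q a b f J"
  shows "Lq_dist q I J = 0"
  using has_Lq_integral_dist_le[OF assms, of "\<lambda>_. 0"] assms(1)
  by (simp add: Lq_dist_def ennreal_eq_0_iff Lq_norm_nonneg antisym)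

section \<open>The singular kernel and uniqueness\<close>

text \<open>The indicator extends the kernel on [a,t] by zero, because the integrals in
  \<open>integral_solution\<close> always start at time 0.\<close>

lemma nn_integral_powr_singular:
  fixes a t \<beta> C :: real
  assumes a: "0 \<le> a" "a \<le> t" and \<beta>: "\<beta> < 1" and C: "C \<ge> 0"
  shows "(\<integral>\<^sup>+\<tau>. ennreal (indicator {a..t} \<tau> * (C * (t - \<tau>) powr (- \<beta>))) \<partial>lebesgue_on {0..t})
    \<le> ennreal (C * (t - a) powr (1 - \<beta>) / (1 - \<beta>))"
proof -
  let ?F = "\<lambda>\<tau>. - (C * (t - \<tau>) powr (1 - \<beta>) / (1 - \<beta>))"
  have "((\<lambda>\<tau>. C * (t - \<tau>) powr (- \<beta>)) has_integral (?F t - ?F a)) {a..t}"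
  proof (rule fundamental_theorem_of_calculus_interior)
    \<comment> \<open>As 1 - \<beta> > 0, the antiderivative is continuous up to \<tau> = t even if
      the integrand blows up there.\<close>
    show "continuous_on {a..t} ?F"
      using \<beta> by (intro continuous_on_minus continuous_on_divide continuous_on_mult continuous_on_powr'
          continuous_on_diff continuous_on_const continuous_on_id) auto
    fix \<tau> assume "\<tau> \<in> {a<..<t}"
    then have "((\<lambda>\<tau>. (t - \<tau>) powr (1 - \<beta>)) has_real_derivative (1 - \<beta>) * (t - \<tau>) powr (1 - \<beta> - 1) * (- 1)) (at \<tau>)"
      by (intro DERIV_chain2[OF has_real_derivative_powr]) (auto intro!: derivative_eq_intros)
    from DERIV_cmult[OF this, of "- (C / (1 - \<beta>))"]
    have "(?F has_real_derivative C * (t - \<tau>) powr (- \<beta>)) (at \<tau>)"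
      using \<beta> by simp
    then show "(?F has_vector_derivative C * (t - \<tau>) powr (- \<beta>)) (at \<tau>)"
      by (simp add: has_real_derivative_iff_has_vector_derivative)
  qed (use a in auto)
  then have "(\<integral>\<^sup>+\<tau>. ennreal (indicator {a..t} \<tau> * (C * (t - \<tau>) powr (- \<beta>))) \<partial>lborel) = ennreal (?F t - ?F a)"
    using C by (intro nn_integral_has_integral_lebesgue) auto
  moreover have "(\<integral>\<^sup>+\<tau>. ennreal (indicator {a..t} \<tau> * (C * (t - \<tau>) powr (- \<beta>))) \<partial>lebesgue_on {0..t})
      \<le> (\<integral>\<^sup>+\<tau>. ennreal (indicator {a..t} \<tau> * (C * (t - \<tau>) powr (- \<beta>))) \<partial>lborel)"
    by (subst nn_integral_restrict_space)
      (auto simp: nn_integral_completion indicator_def intro!: nn_integral_mono)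
  ultimately show ?thesis using \<beta> by simp
qed

lemma continuous_in_Lq_bounded:
  assumes q: "q \<ge> 1" and u: "continuous_in_Lq q T u"
  obtains M where "\<And>t. t \<in> {0..T} \<Longrightarrow> Lq_norm q (u t) \<le> M"
proof -
  have "continuous_on {0..T} (\<lambda>t. Lq_norm q (u t))"
    unfolding continuous_on_def
  proof
    fix t assume t: "t \<in> {0..T}"
    have "((\<lambda>s. Lq_norm q (u s) - Lq_norm q (u t)) \<longlongrightarrow> 0) (at t within {0..T})"
    proof (rule Lim_null_comparison)
      show "((\<lambda>s. Lq_dist q (u s) (u t)) \<longlongrightarrow> 0) (at t within {0..T})"
        using u t by (auto simp: continuous_in_Lq_def)
      show "\<forall>\<^sub>F s in at t within {0..T}. norm (Lq_norm q (u s) - Lq_norm q (u t)) \<le> Lq_dist q (u s) (u t)"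
        unfolding eventually_at_filter
        using u t by (intro always_eventually) (auto simp: continuous_in_Lq_def intro!: abs_Lq_norm_diff_le q)
    qed
    then show "((\<lambda>s. Lq_norm q (u s)) \<longlongrightarrow> Lq_norm q (u t)) (at t within {0..T})"
      by (simp add: LIM_zero_iff)
  qed
  then have "bounded ((\<lambda>t. Lq_norm q (u t)) ` {0..T})"
    by (intro compact_imp_bounded compact_continuous_image) auto
  then obtain M where "\<forall>t\<in>{0..T}. Lq_norm q (u t) \<le> M"
    unfolding bounded_iff by auto
  then show ?thesis using that by blast
qed

text \<open>
  A step length \<open>\<delta>\<close> with \<open>K \<delta>\<^sup>1\<^sup>-\<^sup>\<beta> / (1 - \<beta>) \<le> 1/2\<close> makes the integral inequality a contraction on
  intervals of length \<open>\<delta>\<close>, so \<open>d\<close> vanishes on one such interval after the other.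
\<close>

lemma singular_gronwall_zero:
  fixes d :: "real \<Rightarrow> real"
  assumes nonneg: "\<And>t. t \<in> {0..T} \<Longrightarrow> 0 \<le> d t" and bounded: "\<And>t. t \<in> {0..T} \<Longrightarrow> d t \<le> B"
    and \<beta>: "\<beta> < 1" and K: "K \<ge> 0"
    and step: "\<And>a t D. \<lbrakk>0 \<le> a; a \<le> t; t \<le> T; D \<ge> 0; \<And>\<tau>. 0 \<le> \<tau> \<Longrightarrow> \<tau> < a \<Longrightarrow> d \<tau> = 0;
      \<And>\<tau>. a \<le> \<tau> \<Longrightarrow> \<tau> \<le> t \<Longrightarrow> d \<tau> \<le> D\<rbrakk> \<Longrightarrow> d t \<le> K * D * (t - a) powr (1 - \<beta>) / (1 - \<beta>)"
    and t: "t \<in> {0..T}"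
  shows "d t = 0"
proof -
  \<comment> \<open>Solves (K + 1) \<delta>^(1-\<beta>) / (1 - \<beta>) = 1/2; \<open>K + 1\<close>
    in place of \<open>K\<close> keeps the quotient meaningful for K = 0.\<close>
  define \<delta> where "\<delta> = ((1 - \<beta>) / (2 * (K + 1))) powr (1 / (1 - \<beta>))"
  have \<delta>: "\<delta> > 0" using \<beta> K by (simp add: \<delta>_def)
  have "\<delta> powr (1 - \<beta>) = (1 - \<beta>) / (2 * (K + 1))"
    using \<beta> K by (simp add: \<delta>_def powr_powr)
  then have "(K + 1) * \<delta> powr (1 - \<beta>) = (1 - \<beta>) / 2"
    using K by (simp add: field_simps)
  moreover have "K * \<delta> powr (1 - \<beta>) \<le> (K + 1) * \<delta> powr (1 - \<beta>)"
    by (intro mult_right_mono) auto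
  ultimately have half: "K * \<delta> powr (1 - \<beta>) / (1 - \<beta>) \<le> 1/2"
    using \<beta> by (simp add: pos_divide_le_eq)
  have B: "B \<ge> 0" using nonneg[OF t] bounded[OF t] by simp
  have zero: "\<forall>t\<in>{0..T}. t < real n * \<delta> \<longrightarrow> d t = 0" for n
  proof (induction n)
    case 0
    then show ?case by auto
  next
    case (Suc n)
    \<comment> \<open>The contraction is iterated: starting from the a priori bound
      \<open>B\<close>, each round halves the bound on the next interval, and k tends to infinity
      afterwards.\<close>
    have le: "\<forall>t\<in>{0..T}. t < real (Suc n) * \<delta> \<longrightarrow> d t \<le> B * (1/2) ^ k" for k
    proof (induction k)
      case 0
      then show ?case using bounded by simp
    next
      case (Suc k)
      show ?case
      proof (intro ballI impI)
        fix t assume t: "t \<in> {0..T}" "t < real (Suc n) * \<delta>"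
        show "d t \<le> B * (1/2) ^ Suc k"
        proof (cases "t < real n * \<delta>")
          case True
          then show ?thesis using \<open>\<forall>t\<in>{0..T}. t < real n * \<delta> \<longrightarrow> d t = 0\<close> t B by simp
        next
          case False
          define a where "a = real n * \<delta>"
          have a: "0 \<le> a" "a \<le> t" "t - a \<le> \<delta>"
            using False t \<delta> by (auto simp: a_def algebra_simps)
          have "d t \<le> K * (B * (1/2) ^ k) * (t - a) powr (1 - \<beta>) / (1 - \<beta>)"
          proof (rule step)
            show "d \<tau> = 0" if "0 \<le> \<tau>" "\<tau> < a" for \<tau>
              using that \<open>\<forall>t\<in>{0..T}. t < real n * \<delta> \<longrightarrow> d t = 0\<close> t a by (auto simp: a_def)
            show "d \<tau> \<le> B * (1/2) ^ k" if "a \<le> \<tau>" "\<tau> \<le> t" for \<tau>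
              using that Suc.IH t a by auto
          qed (use a t B in auto)
          also have "\<dots> \<le> K * (B * (1/2) ^ k) * \<delta> powr (1 - \<beta>) / (1 - \<beta>)"
            using a \<beta> K B by (intro divide_right_mono mult_left_mono powr_mono2) auto
          also have "\<dots> = (K * \<delta> powr (1 - \<beta>) / (1 - \<beta>)) * (B * (1/2) ^ k)"
            by simp
          also have "\<dots> \<le> 1/2 * (B * (1/2) ^ k)"
            using half B by (intro mult_right_mono) auto
          finally show ?thesis by simp
        qed
      qed
    qed
    have lim: "(\<lambda>k. B * (1/2) ^ k) \<longlonglongrightarrow> 0"
      using tendsto_mult_right_zero[OF LIMSEQ_realpow_zero[of "1/2"], of B] by simp
    show ?case
    proof (intro ballI impI)
      fix t assume t: "t \<in> {0..T}" "t < real (Suc n) * \<delta>"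
      then have "d t \<le> 0" using le by (intro LIMSEQ_le_const[OF lim]) auto
      then show "d t = 0" using nonneg[OF t(1)] by simp
    qed
  qed
  obtain n where "t / \<delta> < real n" using reals_Archimedean2 by blast
  then show ?thesis using zero[of n] t \<delta> by (simp add: field_simps)
qed

theorem theorem1p2:
  fixes p q \<alpha> \<rho> T :: real
    and w u0 :: "real ^ 'n \<Rightarrow> real"
    and u v :: "real \<Rightarrow> real ^ 'n \<Rightarrow> real"
  assumes "p > 1" and "q \<ge> 1" and "\<alpha> \<ge> 1" and "\<rho> > -1"
    and "q > real CARD('n) * (p - 1) / 2" and "q \<ge> p"
    and "in_Lq q w"
    and "T > 0"
    and "integral_solution p q \<alpha> \<rho> w u0 T u"
    and "integral_solution p q \<alpha> \<rho> w u0 T v"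
  shows "\<forall>t\<in>{0..T}. AE x in lebesgue. u t x = v t x"
proof -
  note p = assms(1) and q = assms(2) and \<alpha> = assms(3) and pq = assms(6)
  have r: "q / p \<ge> 1" "q / p * p = q" using p pq by (auto simp: field_simps)
  define \<beta> where "\<beta> = real CARD('n) * (p - 1) / (2 * q)"
  have \<beta>: "\<beta> < 1" using assms(5) q by (simp add: \<beta>_def field_simps)
  have contu: "continuous_in_Lq q T u" and contv: "continuous_in_Lq q T v"
    using assms(9,10) by (auto simp: integral_solution_def)
  have uL: "in_Lq q (u t)" and vL: "in_Lq q (v t)" if "t \<in> {0..T}" for t
    using that contu contv by (auto simp: continuous_in_Lq_def)
  obtain Mu Mv where Mu: "\<And>t. t \<in> {0..T} \<Longrightarrow> Lq_norm q (u t) \<le> Mu"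
    and Mv: "\<And>t. t \<in> {0..T} \<Longrightarrow> Lq_norm q (v t) \<le> Mv"
    using continuous_in_Lq_bounded[OF q contu] continuous_in_Lq_bounded[OF q contv] by metis
  define M where "M = max Mu Mv"
  have M: "Lq_norm q (u t) \<le> M" "Lq_norm q (v t) \<le> M" if "t \<in> {0..T}" for t
    using Mu[OF that] Mv[OF that] by (auto simp: M_def)
  define L where "L = M powr \<alpha> * (p * (2 * M) powr (p - 1)) + \<alpha> * (2 * M) powr (\<alpha> - 1) * M powr p"
  have L: "L \<ge> 0" using p \<alpha> by (simp add: L_def)
  \<comment> \<open>The time-independent part of the smoothing factor (4 pi (t -
    \<tau>))^(-\<beta>), times the Lipschitz constant \<open>L\<close> of the nonlinear
    term.\<close>
  define K where "K = (4 * pi) powr (- \<beta>) * L"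
  have K: "K \<ge> 0" using L by (simp add: K_def)
  define F where "F f x = Lq_norm q f powr \<alpha> * \<bar>f x\<bar> powr p" for f :: "real ^ 'n \<Rightarrow> real" and x
  have F: "in_Lq (q / p) (F f)" if "in_Lq q f" for f
    unfolding F_def using p that by (intro in_Lq_cmult Lq_norm_abs_powr) auto
  define d where "d t = Lq_dist q (u t) (v t)" for t
  \<comment> \<open>The smoothing lemma is used with r = q/p, for which r p = q and its exponent is
    -\<beta>. The time \<tau> = t is excluded: there the semigroup is the identity and
    \<open>F (u \<tau>)\<close> is only known to lie in L^(q/p).\<close>
  have source: "Lq_dist q (heat_semigroup (t - \<tau>) (F (u \<tau>))) (heat_semigroup (t - \<tau>) (F (v \<tau>)))
      \<le> K * d \<tau> * (t - \<tau>) powr (- \<beta>)" if \<tau>: "\<tau> \<in> {0..T}" "\<tau> < t" for t \<tau>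
  proof -
    let ?\<phi> = "\<lambda>x. F (u \<tau>) x - F (v \<tau>) x"
    have "Lq_dist q (heat_semigroup (t - \<tau>) (F (u \<tau>))) (heat_semigroup (t - \<tau>) (F (v \<tau>)))
        = Lq_norm q (heat_semigroup (t - \<tau>) ?\<phi>)"
      using \<tau> heat_semigroup_diff[OF _ r(1) F[OF uL] F[OF vL]] by (simp add: Lq_dist_def)
    also have "\<dots> \<le> (4 * pi * (t - \<tau>)) powr (- \<beta>) * Lq_norm (q / p) ?\<phi>"
      using heat_semigroup_smoothing(2)[of "t - \<tau>" "q / p" p ?\<phi>] \<tau> p r
        in_Lq_diff[OF r(1) F[OF uL] F[OF vL]] by (simp add: \<beta>_def)
    also have "\<dots> \<le> (4 * pi * (t - \<tau>)) powr (- \<beta>) * (L * d \<tau>)"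
      using Lq_nonlinearity_lipschitz[OF p pq \<alpha> uL M(1) vL M(2)] \<tau>
      by (intro mult_left_mono) (auto simp: L_def d_def F_def Lq_dist_def)
    also have "\<dots> = K * d \<tau> * (t - \<tau>) powr (- \<beta>)"
      using \<tau> by (simp add: K_def powr_mult)
    finally show ?thesis .
  qed
  \<comment> \<open>Replacing d by the constant \<open>D\<close> on [a,t] before integrating yields
    a majorant that is explicit and visibly measurable.\<close>
  have step: "d t \<le> K * D * (t - a) powr (1 - \<beta>) / (1 - \<beta>)"
    if a: "0 \<le> a" "a \<le> t" "t \<le> T" and D: "D \<ge> 0"
      and before: "\<And>\<tau>. 0 \<le> \<tau> \<Longrightarrow> \<tau> < a \<Longrightarrow> d \<tau> = 0"
      and after: "\<And>\<tau>. a \<le> \<tau> \<Longrightarrow> \<tau> \<le> t \<Longrightarrow> d \<tau> \<le> D" for a t D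
  proof -
    have t: "t \<in> {0..T}" using a by simp
    obtain I J where I: "has_Lq_integral q 0 t (\<lambda>\<tau>. heat_semigroup (t - \<tau>) (F (u \<tau>))) I"
      and J: "has_Lq_integral q 0 t (\<lambda>\<tau> x. \<tau> powr \<rho> * heat_semigroup (t - \<tau>) w x) J"
      and u_eq: "AE x in lebesgue. u t x = heat_semigroup t u0 x + I x + J x"
      using assms(9) t unfolding integral_solution_def F_def by blast
    obtain I' J' where I': "has_Lq_integral q 0 t (\<lambda>\<tau>. heat_semigroup (t - \<tau>) (F (v \<tau>))) I'"
      and J': "has_Lq_integral q 0 t (\<lambda>\<tau> x. \<tau> powr \<rho> * heat_semigroup (t - \<tau>) w x) J'"
      and v_eq: "AE x in lebesgue. v t x = heat_semigroup t u0 x + I' x + J' x"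
      using assms(10) t unfolding integral_solution_def F_def by blast
    have L: "in_Lq q I" "in_Lq q I'" "in_Lq q J" "in_Lq q J'"
      using I I' J J' by (auto simp: has_Lq_integral_def)
    have "AE x in lebesgue. J x - J' x = 0"
      using has_Lq_integral_unique[OF q J J'] Lq_norm_eq_0_iff[OF _ in_Lq_diff[OF q L(3,4)]] q
      by (simp add: Lq_dist_def)
    with u_eq v_eq have "AE x in lebesgue. u t x - v t x = I x - I' x"
      by eventually_elim simp
    then have "d t = Lq_dist q I I'"
      unfolding d_def Lq_dist_def using in_Lq_diff[OF q uL[OF t] vL[OF t]] in_Lq_diff[OF q L(1,2)]
      by (intro Lq_norm_cong_AE) (auto dest: in_Lq_measurable)
    also have "ennreal \<dots> \<le> (\<integral>\<^sup>+\<tau>. ennreal (indicator {a..t} \<tau> * (K * D * (t - \<tau>) powr (- \<beta>))) \<partial>lebesgue_on {0..t})"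
    proof (rule has_Lq_integral_dist_le[OF q I I'])
      have "(\<lambda>\<tau>. ennreal (indicator {a..t} \<tau> * (K * D * (t - \<tau>) powr (- \<beta>)))) \<in> borel_measurable lebesgue"
        by (intro measurable_completion) measurable
      then show "(\<lambda>\<tau>. ennreal (indicator {a..t} \<tau> * (K * D * (t - \<tau>) powr (- \<beta>)))) \<in> borel_measurable (lebesgue_on {0..t})"
        by (rule measurable_restrict_space1)
      \<comment> \<open>The one time not covered by \<open>source\<close> is a null set.\<close>
      have "AE \<tau> in lebesgue_on {0..t}. \<tau> \<noteq> t"
        using AE_completion[OF AE_lborel_singleton[of t]] by (subst AE_restrict_space_iff) auto
      then show "AE \<tau> in lebesgue_on {0..t}. ennreal (Lq_dist q (heat_semigroup (t - \<tau>) (F (u \<tau>))) (heat_semigroup (t - \<tau>) (F (v \<tau>))))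
          \<le> ennreal (indicator {a..t} \<tau> * (K * D * (t - \<tau>) powr (- \<beta>)))"
        using AE_space
      proof eventually_elim
        case (elim \<tau>)
        then have \<tau>: "\<tau> \<in> {0..T}" "\<tau> < t" using t by auto
        have "K * d \<tau> * (t - \<tau>) powr (- \<beta>) \<le> indicator {a..t} \<tau> * (K * D * (t - \<tau>) powr (- \<beta>))"
        proof (cases "\<tau> < a")
          case True
          then show ?thesis using before[of \<tau>] \<tau> by simp
        next
          case False
          then show ?thesis using after[of \<tau>] \<tau> K by (simp add: mult_left_mono mult_right_mono)
        qed
        then show ?case using source[OF \<tau>] by (intro ennreal_leI) simp
      qed
    qed
    also have "\<dots> \<le> ennreal (K * D * (t - a) powr (1 - \<beta>) / (1 - \<beta>))"
      using a \<beta> K D by (intro nn_integral_powr_singular) auto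
    finally show ?thesis
      using K D \<beta> by (subst (asm) ennreal_le_iff) auto
  qed
  have "d t = 0" if t: "t \<in> {0..T}" for t
  proof (rule singular_gronwall_zero[where d = d and B = "2 * M", OF _ _ \<beta> K step t])
    show "d s \<le> 2 * M" if s: "s \<in> {0..T}" for s
    proof -
      have "d s \<le> Lq_dist q (u s) (\<lambda>x. 0) + Lq_dist q (\<lambda>x. 0) (v s)"
        unfolding d_def using q by (intro Lq_dist_triangle uL vL s) auto
      then show ?thesis
        using M[OF s] by (simp add: Lq_dist_def)
    qed
  qed (auto simp: d_def)
  then have "AE x in lebesgue. u t x - v t x = 0" if "t \<in> {0..T}" for t
    using that Lq_norm_eq_0_iff[OF _ in_Lq_diff[OF q uL vL]] q by (simp add: d_def Lq_dist_def)
  then show ?thesis by simp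
qed

end
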